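(* There exists a universal (absolute) constant $C_{11}>0$ such that the following holds. Let $N\ge3$, $\epsilon>0$, $q'\in(1,2]$, let $R^*\ge\max\{1,\frac12V_{q'}(\mathbf x^* )\}$ be arbitrary and $\lambda_0:=\frac{\epsilon}{2R^*}$. Let $\widehat{\mathbf x}$ be a $(\delta,q)$-approximate solution to the regularized SAA problem $\min_{\mathbf x\in\mathcal X}F_{\lambda_0,N}(\mathbf x)$ with some $q$ such that $q'\le q\le2$ and $\delta\le\frac1N$. Suppose that: (i) for almost every $\xi\in\Xi$, $f(\cdot,\xi)$ is convex on $B$; (ii) for some $p$ with $2\le p\le q'/(q'-1)$ and some $\psi_p\ge1$, for every $\mathbf z\in\mathcal X^{*,\epsilon}$, $F$ is differentiable at $\mathbf z$ with $\mathbb E[G(\mathbf z,\xi)]=\nabla F(\mathbf z)$ and $\big\|G(\mathbf z,\xi)-\mathbb E[G(\mathbf z,\xi)]\big\|_{L^p}\le\psi_p$. Then there exists $\mathbf x^{*,\epsilon}\in\mathcal X^{*,\epsilon}$ that satisfies the following for any $\vartheta>0$ and $\beta\in(0,1)$: $$\mathbb E\left[\|\mathbf x^{*,\epsilon}-\widehat{\mathbf x}\|_q^2\right]\le\vartheta\quad\text{if}\quad N\ge\frac{C_{11}\,p\,\psi_p^2\,(R^* )^2}{(q'-1)^2\,\epsilon^2\,\vartheta},$$ and $$\Pr\left[\|\mathbf x^{*,\epsilon}-\widehat{\mathbf x}\|_q^2\le\vartheta\right]\ge1-\beta\quad\text{if}\quad N\ge\frac{C_{11}\,p\,\psi_p^2\,(R^*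 )^2}{(q'-1)^2\,\epsilon^2\,\vartheta}\cdot\beta^{-\frac2p}.$$
   Context: Setting. $(\Omega,\mathcal F,\Pr)$ is a complete probability space, $\Xi$ is a Borel subset of $\mathbb R^m$, and $\xi$ is a $\Xi$-valued random vector with distribution $P$. $B\subseteq\mathbb R^d$ is open and convex, $\mathcal X\subseteq B$ is non-empty, closed and convex, and $f:B\times\Xi\to\mathbb R$ is $\mathcal B(B)\otimes\mathcal B(\Xi)$-measurable. $F(\mathbf x):=\mathbb E[f(\mathbf x,\xi)]$ is well-defined and finite for all $\mathbf x\in\mathcal X$ and admits a minimizer $\mathbf x^*$ on $\mathcal X$. The set of $\epsilon$-suboptimal solutions is $\mathcal X^{*,\epsilon}:=\{\mathbf x\in\mathcal X:F(\mathbf x)\le F(\mathbf x^* )+\epsilon\}$. $G:\mathcal X\times\Xi\to\mathbb R^d$ is a deterministic, universally measurable function such that, for all $\mathbf x\in\mathcal X$, $G(\mathbf x,\xi)\in\partial_{\mathbf x}f(\mathbf x,\xi)$ for almost every $\xi\in\Xi$. Here $\partial$ (or $\partial_{\mathbf x}$) denotes the subdifferential of convex analysis (with respect to $\mathbf x$). $\|\cdot\|_q$ is the usual $q$-norm on $\mathbb R^d$, and for a random vector $\boldsymbol\zeta=(\zeta_i)\in\mathbb R^d$, $\|\boldsymbol\zeta\|_{L^p}:=\big(\sum_{i=1}^d\mathbb E[|\zeta_i|^p]\big)^{1/p}$. Regularized SAA. For a positive integer $N$, $\boldsymbol\xi_{1,N}=(\xi_1,\dots,\xi_N)$ is an i.i.d.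 sample of $\xi$ and $F_N(\mathbf x):=N^{-1}\sum_{j=1}^Nf(\mathbf x,\xi_j)$. For $q'\in(1,2]$ and a fixed initial guess $\mathbf x^0\in\mathcal X$, $V_{q'}(\mathbf x):=\frac12\|\mathbf x-\mathbf x^0\|_{q'}^2$, and $F_{\lambda_0,N}(\mathbf x):=F_N(\mathbf x)+\lambda_0V_{q'}(\mathbf x)$. Approximate solution. For $q\ge1$ and $\delta\ge0$, a random vector $\widehat{\mathbf x}=\widetilde{\mathbf x}(\boldsymbol\xi_{1,N})\in\mathcal X$ is a $(\delta,q)$-approximate solution to $\min_{\mathbf x\in\mathcal X}F_{\lambda_0,N}(\mathbf x)$ if $\widetilde{\mathbf x}:\Xi^N\to\mathcal X$ is a deterministic $\mathcal B(\Xi^N)$-measurable function such that, for some $\mathbf g\in\partial F_{\lambda_0,N}(\widetilde{\mathbf x}(\boldsymbol\xi_{1,N}))$, $\langle\mathbf g,\mathbf x-\widetilde{\mathbf x}(\boldsymbol\xi_{1,N})\rangle\ge-\delta\|\mathbf x-\widetilde{\mathbf x}(\boldsymbol\xi_{1,N})\|_q$ for all $\mathbf x\in\mathcal X$. *)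

theory Defs
  imports "HOL-Probability.Probability" "HOL-Library.Function_Algebras"
begin

text \<open>
  The constant of the theorem must not depend on the dimensions, so \<open>\<real>\<^sup>d\<close> cannot be a type indexed
  by \<open>d\<close>. It is represented, as in \<^const>\<open>Euclidean_space\<close>, by the sequences that vanish from
  index \<open>d\<close> on. The ambient type carries the product topology, whose Borel sets induce the usual
  ones on each \<open>\<real>\<^sup>d\<close>; with the pointwise vector space structure below, \<^const>\<open>convex\<close>
  and \<^const>\<open>convex_on\<close> have their usual meaning.
\<close>

instantiation "fun" :: (type, real_vector) real_vector
begin

definition scaleR_fun :: "real \<Rightarrow> ('a \<Rightarrow> 'b) \<Rightarrow> 'a \<Rightarrow> 'b"
  where "scaleR_fun c x = (\<lambda>i. c *\<^sub>R x i)"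

instance
  by standard (auto simp: scaleR_fun_def fun_eq_iff scaleR_add_right scaleR_add_left)

end

type_synonym rvec = "nat \<Rightarrow> real"

definition Rn :: "nat \<Rightarrow> rvec set"
  where "Rn d = topspace (Euclidean_space d)"

definition dot :: "nat \<Rightarrow> rvec \<Rightarrow> rvec \<Rightarrow> real"
  where "dot d x y = (\<Sum>i<d. x i * y i)"

definition lq_norm :: "nat \<Rightarrow> real \<Rightarrow> rvec \<Rightarrow> real"
  where "lq_norm d q x = (\<Sum>i<d. \<bar>x i\<bar> powr q) powr (1 / q)"

definition subdifferential :: "nat \<Rightarrow> rvec set \<Rightarrow> (rvec \<Rightarrow> real) \<Rightarrow> rvec \<Rightarrow> rvec set"
  where "subdifferential d B h x = {g \<in> Rn d. \<forall>y\<in>B. h x + dot d g (y - x) \<le> h y}"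

definition has_gradient :: "nat \<Rightarrow> (rvec \<Rightarrow> real) \<Rightarrow> rvec \<Rightarrow> rvec \<Rightarrow> bool"
  where "has_gradient d h v z \<longleftrightarrow> v \<in> Rn d \<and>
    (\<forall>e>0. \<exists>r>0. \<forall>y\<in>Rn d. lq_norm d 2 (y - z) < r \<longrightarrow>
       \<bar>h y - h z - dot d v (y - z)\<bar> \<le> e * lq_norm d 2 (y - z))"

definition universally_measurable :: "'a measure \<Rightarrow> 'b measure \<Rightarrow> ('a \<Rightarrow> 'b) \<Rightarrow> bool"
  where "universally_measurable A T g \<longleftrightarrow>
    (\<forall>\<mu>. finite_measure \<mu> \<and> sets \<mu> = sets A \<longrightarrow> g \<in> measurable (completion \<mu>) T)"

definition expected_cost :: "'w measure \<Rightarrow> ('w \<Rightarrow> rvec) \<Rightarrow> (rvec \<Rightarrow> rvec \<Rightarrow> real) \<Rightarrow> rvec \<Rightarrow> real"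
  where "expected_cost M xi f x = (\<integral>w. f x (xi w) \<partial>M)"

definition eps_optimal :: "rvec set \<Rightarrow> (rvec \<Rightarrow> real) \<Rightarrow> rvec \<Rightarrow> real \<Rightarrow> rvec set"
  where "eps_optimal X F xstar \<epsilon> = {x \<in> X. F x \<le> F xstar + \<epsilon>}"

definition mean_vec :: "'w measure \<Rightarrow> ('w \<Rightarrow> rvec) \<Rightarrow> rvec"
  where "mean_vec M Z = (\<lambda>i. \<integral>w. Z w i \<partial>M)"

definition Lp_norm :: "nat \<Rightarrow> real \<Rightarrow> 'w measure \<Rightarrow> ('w \<Rightarrow> rvec) \<Rightarrow> real"
  where "Lp_norm d p M Z = (\<Sum>i<d. \<integral>w. \<bar>Z w i\<bar> powr p \<partial>M) powr (1 / p)"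

definition regularizer :: "nat \<Rightarrow> real \<Rightarrow> rvec \<Rightarrow> rvec \<Rightarrow> real"
  where "regularizer d q' x0 x = (lq_norm d q' (x - x0))\<^sup>2 / 2"

definition saa_objective ::
    "nat \<Rightarrow> (rvec \<Rightarrow> rvec \<Rightarrow> real) \<Rightarrow> nat \<Rightarrow> real \<Rightarrow> real \<Rightarrow> rvec \<Rightarrow> (nat \<Rightarrow> rvec) \<Rightarrow> rvec \<Rightarrow> real"
  where "saa_objective d f N lam q' x0 s x =
    (\<Sum>j<N. f x (s j)) / real N + lam * regularizer d q' x0 x"

locale stochastic_program = prob_space M + complete_measure M
  for M :: "'w measure" +
  fixes d m :: nat
    and Xi :: "rvec set" and xi :: "'w \<Rightarrow> rvec"
    and B X :: "rvec set"
    and f :: "rvec \<Rightarrow> rvec \<Rightarrow> real"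
    and xstar :: rvec
    and G :: "rvec \<Rightarrow> rvec \<Rightarrow> rvec"
  assumes dims: "1 \<le> d" "1 \<le> m"
    and Xi: "Xi \<subseteq> Rn m" "Xi \<in> sets borel"
    and xi: "xi \<in> measurable M (restrict_space borel Xi)"
    and B: "openin (Euclidean_space d) B" "convex B"
    and X: "X \<noteq> {}" "X \<subseteq> B" "closedin (Euclidean_space d) X" "convex X"
    and f: "case_prod f \<in> borel_measurable (restrict_space borel B \<Otimes>\<^sub>M restrict_space borel Xi)"
    and F_finite: "\<And>x. x \<in> X \<Longrightarrow> integrable M (\<lambda>w. f x (xi w))"
    and xstar: "xstar \<in> X" "\<And>x. x \<in> X \<Longrightarrow> expected_cost M xi f xstar \<le> expected_cost M xi f x"
    and G_measurable: "universally_measurable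
      (restrict_space borel X \<Otimes>\<^sub>M restrict_space borel Xi) (restrict_space borel (Rn d)) (case_prod G)"
    and G_subgradient: "\<And>x. x \<in> X \<Longrightarrow>
      AE u in distr M (restrict_space borel Xi) xi. G x u \<in> subdifferential d B (\<lambda>y. f y u) x"

text \<open>
  The condition on the approximate solution is imposed for almost every sample, i.e. almost
  everywhere for the law of the i.i.d. sample on \<open>\<Xi>\<^sup>N\<close>. Bochner integrals of non-integrable
  functions are 0, so integrability is always required alongside an integral. Differentiability of
  the expected cost at \<open>z\<close> presupposes that it is finite near \<open>z\<close>.
\<close>

locale regularized_saa = stochastic_program M d m Xi xi B X f xstar G
  for M :: "'w measure" and d m Xi xi B X f xstar G +
  fixes N :: nat
    and sample :: "nat \<Rightarrow> 'w \<Rightarrow> rvec"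
    and \<epsilon> q' :: real and x0 :: rvec and R :: real
    and q \<delta> :: real and xt :: "(nat \<Rightarrow> rvec) \<Rightarrow> rvec"
    and p \<psi> :: real
  assumes N: "3 \<le> N"
    and sample_indep: "indep_vars (\<lambda>_. restrict_space borel Xi) sample {..<N}"
    and sample_law: "\<And>j. j < N \<Longrightarrow>
      distr M (restrict_space borel Xi) (sample j) = distr M (restrict_space borel Xi) xi"
    and eps: "0 < \<epsilon>"
    and q': "1 < q'" "q' \<le> 2"
    and x0: "x0 \<in> X"
    and R: "max 1 (regularizer d q' x0 xstar / 2) \<le> R"
    and q: "q' \<le> q" "q \<le> 2"
    and delta: "0 \<le> \<delta>" "\<delta> \<le> 1 / real N"
    and xt_measurable: "xt \<in> measurable (\<Pi>\<^sub>M j\<in>{..<N}. restrict_space borel Xi) (restrict_space borel X)"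
    and xt_approx: "AE s in (\<Pi>\<^sub>M j\<in>{..<N}. distr M (restrict_space borel Xi) xi).
      \<exists>g \<in> subdifferential d B (saa_objective d f N (\<epsilon> / (2 * R)) q' x0 s) (xt s).
        \<forall>x\<in>X. - \<delta> * lq_norm d q (x - xt s) \<le> dot d g (x - xt s)"
    and f_convex: "AE u in distr M (restrict_space borel Xi) xi. convex_on B (\<lambda>x. f x u)"
    and p: "2 \<le> p" "p \<le> q' / (q' - 1)"
    and psi: "1 \<le> \<psi>"
    and F_finite_near: "\<And>z. z \<in> eps_optimal X (expected_cost M xi f) xstar \<epsilon> \<Longrightarrow>
      \<exists>U. openin (Euclidean_space d) U \<and> z \<in> U \<and> U \<subseteq> B \<and>
        (\<forall>x\<in>U. integrable M (\<lambda>w. f x (xi w)))"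
    and G_integrable: "\<And>z i. z \<in> eps_optimal X (expected_cost M xi f) xstar \<epsilon> \<Longrightarrow> i < d \<Longrightarrow>
      integrable M (\<lambda>w. G z (xi w) i)"
    and F_gradient: "\<And>z. z \<in> eps_optimal X (expected_cost M xi f) xstar \<epsilon> \<Longrightarrow>
      has_gradient d (expected_cost M xi f) (mean_vec M (\<lambda>w. G z (xi w))) z"
    and G_moment_finite: "\<And>z i. z \<in> eps_optimal X (expected_cost M xi f) xstar \<epsilon> \<Longrightarrow> i < d \<Longrightarrow>
      integrable M (\<lambda>w. \<bar>(G z (xi w) - mean_vec M (\<lambda>w. G z (xi w))) i\<bar> powr p)"
    and G_moment: "\<And>z. z \<in> eps_optimal X (expected_cost M xi f) xstar \<epsilon> \<Longrightarrow>
      Lp_norm d p M (\<lambda>w. G z (xi w) - mean_vec M (\<lambda>w. G z (xi w))) \<le> \<psi>"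

definition saa_estimator ::
    "nat \<Rightarrow> (nat \<Rightarrow> 'w \<Rightarrow> rvec) \<Rightarrow> ((nat \<Rightarrow> rvec) \<Rightarrow> rvec) \<Rightarrow> 'w \<Rightarrow> rvec"
  where "saa_estimator N sample xt w = xt (\<lambda>j\<in>{..<N}. sample j w)"

definition error_bounds ::
    "real \<Rightarrow> 'w measure \<Rightarrow> nat \<Rightarrow> rvec set \<Rightarrow> nat \<Rightarrow> real \<Rightarrow> real \<Rightarrow> real \<Rightarrow> real \<Rightarrow> real \<Rightarrow> real
      \<Rightarrow> ('w \<Rightarrow> rvec) \<Rightarrow> bool"
  where "error_bounds C M d S N \<epsilon> q' R q p \<psi> xhat \<longleftrightarrow>
    (\<exists>xe\<in>S. \<forall>\<theta>>0. \<forall>\<beta>. 0 < \<beta> \<and> \<beta> < 1 \<longrightarrow>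
      (C * p * \<psi>\<^sup>2 * R\<^sup>2 / ((q' - 1)\<^sup>2 * \<epsilon>\<^sup>2 * \<theta>) \<le> real N \<longrightarrow>
        integrable M (\<lambda>w. (lq_norm d q (xe - xhat w))\<^sup>2) \<and>
        (\<integral>w. (lq_norm d q (xe - xhat w))\<^sup>2 \<partial>M) \<le> \<theta>) \<and>
      (C * p * \<psi>\<^sup>2 * R\<^sup>2 / ((q' - 1)\<^sup>2 * \<epsilon>\<^sup>2 * \<theta>) * \<beta> powr (- (2 / p)) \<le> real N \<longrightarrow>
        1 - \<beta> \<le> measure M {w \<in> space M. (lq_norm d q (xe - xhat w))\<^sup>2 \<le> \<theta>}))"

text \<open>
  An existential quantifier in a theorem about an arbitrary type of outcomes \<open>'w\<close> would allow the
  constant to depend on that type. So the constant is a closed term: any positive number that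
  works for all data whose outcomes lie in one fixed type. That type is rich enough to carry
  \<open>(\<xi>, \<xi>\<^sub>1, \<dots>, \<xi>\<^sub>N)\<close> as coordinate functions, and the claim depends only on the law of this
  tuple; the theorem asserts that the same number is valid for every \<open>'w\<close>.
\<close>

definition C11 :: real
  where "C11 = (SOME C. 0 < C \<and>
    (\<forall>(M :: (nat \<Rightarrow> rvec) measure) d m Xi xi B X f xstar G N sample \<epsilon> q' x0 R q \<delta> xt p \<psi>.
      regularized_saa M d m Xi xi B X f xstar G N sample \<epsilon> q' x0 R q \<delta> xt p \<psi> \<longrightarrow>
      error_bounds C M d (eps_optimal X (expected_cost M xi f) xstar \<epsilon>) N \<epsilon> q' R q p \<psi>
        (saa_estimator N sample xt)))"

end

theory Submission
  imports Defs
begin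

text \<open>
  Take for \<open>x\<^sup>*\<^sup>,\<^sup>\<epsilon>\<close> the minimizer \<open>e\<close> of the regularized true objective \<open>F + \<lambda>\<^sub>0 V\<close> on \<open>X\<close>. It is
  \<open>\<epsilon>\<close>-optimal because \<open>\<lambda>\<^sub>0 V xstar \<le> \<epsilon>\<close>. The squared \<open>q'\<close>-norm is strongly convex with modulus
  proportional to \<open>q' - 1\<close> (Ball, Carlen and Lieb), so comparing the optimality of \<open>e\<close> with the
  approximate optimality of the estimator bounds their distance by a multiple of
  \<open>R / (\<epsilon> (q' - 1)) * (\<delta> + T)\<close>, where \<open>T\<close> is the \<open>p\<close>-norm of the sampling error of the gradient at the
  single, deterministic point \<open>e\<close>. No uniform bound over \<open>X\<close> is needed. The \<open>p\<close>-th moment of \<open>T\<close> is at most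
  \<open>(6 p \<psi>\<^sup>2 / N)\<^sup>p\<^sup>/\<^sup>2\<close> by a Marcinkiewicz--Zygmund inequality with constant of order \<open>\<surd>p\<close>, and both
  claims follow, the second by Markov's inequality. This gives the constant 224. Since hypotheses and
  conclusion depend only on the laws of \<open>xi\<close> and of the sample, any problem can be moved to a product
  space over sequences, which is where \<open>C11\<close> is chosen.
\<close>

section \<open>Inequalities for real powers\<close>

text \<open>For negative \<open>s\<close> combine \<open>exp (- s) \<ge> 1 - s\<close> with the
  identity \<open>(1 + s + s^2) * (1 - s) = 1 - s^3\<close>, whose value is at least 1.\<close>

lemma exp_le_quadratic:
  fixes s :: real
  assumes "\<bar>s\<bar> \<le> 1"
  shows "exp s \<le> 1 + s + s\<^sup>2"
proof (cases "0 \<le> s")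
  case True
  then show ?thesis using exp_bound[of s] assms by simp
next
  case False
  have "1 \<le> (1 + s + s\<^sup>2) * (1 - s)"
  proof -
    have "(1 + s + s\<^sup>2) * (1 - s) = 1 - s * s\<^sup>2"
      by (simp add: algebra_simps power2_eq_square)
    moreover have "s * s\<^sup>2 \<le> 0" using False by (intro mult_nonpos_nonneg) auto
    ultimately show ?thesis by simp
  qed
  moreover have "1 - s \<le> exp (- s)" using exp_ge_add_one_self[of "- s"] by simp
  moreover have "0 \<le> 1 + s + s\<^sup>2" using assms by (simp add: abs_le_iff)
  ultimately have "1 \<le> (1 + s + s\<^sup>2) * exp (- s)"
    by (meson mult_left_mono order_trans)
  then have "1 * exp s \<le> (1 + s + s\<^sup>2) * exp (- s) * exp s"
    by (intro mult_right_mono) auto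
  then show ?thesis by (simp add: mult.assoc flip: exp_add)
qed

text \<open>Weighted AM-GM between \<open>1 + r * (u - 1)\<close> and 1, with weights
  \<open>1 / r\<close> and \<open>1 - 1 / r\<close>, has exactly \<open>u\<close> on its right side.
  This tangent bound supplies the convexity of powers and Jensen's inequality below.\<close>

lemma Bernoulli_powr:
  fixes u r :: real
  assumes "0 \<le> u" "1 \<le> r"
  shows "1 + r * (u - 1) \<le> u powr r"
proof (cases "0 < 1 + r * (u - 1)")
  case True
  let ?w = "1 + r * (u - 1)"
  have "?w powr (1 / r) * 1 powr (1 - 1 / r) \<le> (1 / r) * ?w + (1 - 1 / r) * 1"
    using assms True by (intro Youngs_inequality_0) auto
  also have "\<dots> = u" using assms by (simp add: field_simps)
  finally have "(?w powr (1 / r)) powr r \<le> u powr r"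
    using assms by (intro powr_mono2) auto
  then show ?thesis using assms True by (simp add: powr_powr)
next
  case False
  then show ?thesis by (smt (verit) powr_ge_zero)
qed

text \<open>Apply the tangent bound at both points divided by their weighted mean: the linear terms
  average to zero and 1 remains.\<close>

lemma powr_convex_combination_le:
  fixes u w r :: real
  assumes "0 \<le> u" "0 \<le> w" "1 \<le> r" "0 \<le> \<alpha>" "0 \<le> \<beta>" "\<alpha> + \<beta> = 1"
  shows "(\<alpha> * u + \<beta> * w) powr r \<le> \<alpha> * u powr r + \<beta> * w powr r"
proof (cases "\<alpha> * u + \<beta> * w = 0")
  case True
  then show ?thesis using assms by simp
next
  case False
  let ?m = "\<alpha> * u + \<beta> * w"
  have m: "0 < ?m" using False assms by (smt (verit) mult_nonneg_nonneg)
  have "\<alpha> * (1 + r * (u / k - 1)) + \<beta> * (1 + r * (w / k - 1))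
      = (\<alpha> + \<beta>) + r * ((\<alpha> * u + \<beta> * w) / k - (\<alpha> + \<beta>))" if "0 < k" for k
    using that by (simp add: field_simps)
  from this[OF m] have "1 = \<alpha> * (1 + r * (u / ?m - 1)) + \<beta> * (1 + r * (w / ?m - 1))"
    using m assms(6) by simp
  also have "\<dots> \<le> \<alpha> * (u / ?m) powr r + \<beta> * (w / ?m) powr r"
    using assms m by (intro add_mono mult_left_mono Bernoulli_powr) auto
  also have "\<dots> = (\<alpha> * u powr r + \<beta> * w powr r) / ?m powr r"
    by (simp add: powr_divide add_divide_distrib)
  finally show ?thesis using m by (simp add: field_simps)
qed

lemma powr_add_le_weighted:
  fixes u w r :: real
  assumes "0 \<le> u" "0 \<le> w" "1 \<le> r" "0 < \<alpha>" "0 < \<beta>" "\<alpha> + \<beta> = 1"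
  shows "(u + w) powr r \<le> \<alpha> powr (1 - r) * u powr r + \<beta> powr (1 - r) * w powr r"
proof -
  have "(\<alpha> * (u / \<alpha>) + \<beta> * (w / \<beta>)) powr r \<le> \<alpha> * (u / \<alpha>) powr r + \<beta> * (w / \<beta>) powr r"
    using assms by (intro powr_convex_combination_le) auto
  then show ?thesis
    using assms by (simp add: powr_divide powr_diff)
qed

text \<open>The two summands on the left are put into the convex bound with exponent
  \<open>1 / r\<close>. Its weights cancel the factors \<open>\<alpha> powr (1 - r)\<close> and
  \<open>\<beta> powr (1 - r)\<close> exactly, leaving \<open>u + w\<close>.\<close>

lemma powr_add_ge_weighted:
  fixes u w r :: real
  assumes "0 \<le> u" "0 \<le> w" "0 < r" "r \<le> 1" "0 < \<alpha>" "0 < \<beta>" "\<alpha> + \<beta> = 1"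
  shows "\<alpha> powr (1 - r) * u powr r + \<beta> powr (1 - r) * w powr r \<le> (u + w) powr r"
proof -
  let ?x = "\<alpha> powr (1 - r) * u powr r" and ?y = "\<beta> powr (1 - r) * w powr r"
  have *: "a powr (1 - 1 / r) * (a powr (1 - r) * b powr r) powr (1 / r) = b"
    if "0 < a" "0 \<le> b" for a b
    using that assms by (auto simp: powr_mult powr_powr powr_add[symmetric] field_simps)
  have "(?x + ?y) powr (1 / r) \<le> \<alpha> powr (1 - 1 / r) * ?x powr (1 / r) + \<beta> powr (1 - 1 / r) * ?y powr (1 / r)"
    using assms by (intro powr_add_le_weighted) auto
  also have "\<dots> = u + w" using assms by (simp add: *)
  finally have "((?x + ?y) powr (1 / r)) powr r \<le> (u + w) powr r"
    using assms by (intro powr_mono2) auto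
  then show ?thesis using assms by (simp add: powr_powr)
qed

section \<open>Second-order bounds for p-th powers with an explicit linear term\<close>

lemma abs_powr_eq_power2_powr: "\<bar>x\<bar> powr p = (x\<^sup>2) powr (p / 2)" for x p :: real
proof -
  have "x\<^sup>2 = \<bar>x\<bar> powr 2" by simp
  then show ?thesis by (simp only: powr_powr) simp
qed

text \<open>The linear term is kept exact so that it can average out under independence. The
  coefficient \<open>6 * p\<close> of the square is linear in \<open>p\<close>, which later yields a
  moment constant of order sqrt p. For \<open>p * \<bar>y\<bar> < 1\<close> the exponential is
  expanded; otherwise the linear term is absorbed into the power.\<close>

lemma abs_one_add_powr_le:
  fixes y p :: real
  assumes p: "2 \<le> p"
  shows "\<bar>1 + y\<bar> powr p \<le> p * y + (1 + 6 * p * y\<^sup>2) powr (p / 2)"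
proof (cases "p * \<bar>y\<bar> < 1")
  case True
  have y: "\<bar>y\<bar> < 1" 
  proof (rule ccontr)
    assume "\<not> \<bar>y\<bar> < 1"
    then have "1 * 1 \<le> p * \<bar>y\<bar>" using p by (intro mult_mono) auto
    then show False using True by simp
  qed
  have "\<bar>1 + y\<bar> powr p \<le> exp y powr p"
    using y p exp_ge_add_one_self[of y] by (intro powr_mono2) auto
  also have "\<dots> = exp (p * y)" by (simp add: powr_def)
  also have "\<dots> \<le> 1 + p * y + (p * y)\<^sup>2"
    using True p by (intro exp_le_quadratic) (simp add: abs_mult)
  finally have "\<bar>1 + y\<bar> powr p \<le> p * y + (1 + (p * y)\<^sup>2)" by simp
  \<comment> \<open>Bernoulli with exponent \<open>p / 2\<close> turns \<open>6 * p * y^2\<close>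
    into \<open>3 * p^2 * y^2\<close>, more than is required.\<close>
  moreover have "1 + (p * y)\<^sup>2 \<le> 1 + (p / 2) * ((1 + 6 * p * y\<^sup>2) - 1)"
    using p by (simp add: power_mult_distrib power2_eq_square)
  moreover have "\<dots> \<le> (1 + 6 * p * y\<^sup>2) powr (p / 2)"
    using p by (intro Bernoulli_powr) auto
  ultimately show ?thesis by linarith
next
  case False
  \<comment> \<open>With \<open>t = \<bar>y\<bar> / (1 + \<bar>y\<bar>)\<close>, adding
    \<open>p * \<bar>y\<bar>\<close> costs at most the factor
    \<open>1 + p * t \<le> (1 + t) powr p\<close>, and
    \<open>(1 + \<bar>y\<bar>) * (1 + t) = 1 + 2 * \<bar>y\<bar>\<close>.\<close>
  have "\<bar>1 + y\<bar> powr p + p * \<bar>y\<bar> \<le> (1 + \<bar>y\<bar>) powr p * (1 + p * (\<bar>y\<bar> / (1 + \<bar>y\<bar>)))"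
  proof -
    have "(1 + \<bar>y\<bar>) powr 1 \<le> (1 + \<bar>y\<bar>) powr p" using p by (intro powr_mono) auto
    then have "p * (\<bar>y\<bar> / (1 + \<bar>y\<bar>) * (1 + \<bar>y\<bar>)) \<le> p * (\<bar>y\<bar> / (1 + \<bar>y\<bar>) * (1 + \<bar>y\<bar>) powr p)"
      using p by (intro mult_left_mono) auto
    moreover have "\<bar>y\<bar> / (1 + \<bar>y\<bar>) * (1 + \<bar>y\<bar>) = \<bar>y\<bar>" by simp
    ultimately have "p * \<bar>y\<bar> \<le> p * (\<bar>y\<bar> / (1 + \<bar>y\<bar>) * (1 + \<bar>y\<bar>) powr p)"
      by metis
    moreover have "\<bar>1 + y\<bar> powr p \<le> (1 + \<bar>y\<bar>) powr p" using p by (intro powr_mono2) auto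
    ultimately show ?thesis by (simp add: algebra_simps)
  qed
  also have "\<dots> \<le> (1 + \<bar>y\<bar>) powr p * (1 + \<bar>y\<bar> / (1 + \<bar>y\<bar>)) powr p"
    using Bernoulli_powr[of "1 + \<bar>y\<bar> / (1 + \<bar>y\<bar>)" p] p by (intro mult_left_mono) auto
  also have "\<dots> = (1 + 2 * \<bar>y\<bar>) powr p"
    by (subst powr_mult[symmetric]) (simp add: distrib_left add.commute)
  also have "\<dots> = ((1 + 2 * \<bar>y\<bar>)\<^sup>2) powr (p / 2)"
    by (simp add: powr_powr flip: powr_numeral)
  also have "\<dots> \<le> (1 + 6 * p * y\<^sup>2) powr (p / 2)"
  proof (intro powr_mono2)
    \<comment> \<open>Here the 6 arises: \<open>p * \<bar>y\<bar> \<ge> 1\<close> pays for the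
      constant 4, and \<open>p \<ge> 2\<close> pays for \<open>4 * \<bar>y\<bar>\<close> with
      another \<open>2 * p * \<bar>y\<bar>\<close>.\<close>
    have "4 + 4 * \<bar>y\<bar> \<le> 4 * (p * \<bar>y\<bar>) + 2 * (p * \<bar>y\<bar>)"
      using False mult_right_mono[OF p, of "\<bar>y\<bar>"] by linarith
    then have "(4 + 4 * \<bar>y\<bar>) * \<bar>y\<bar> \<le> (6 * (p * \<bar>y\<bar>)) * \<bar>y\<bar>"
      by (intro mult_right_mono) auto
    then show "(1 + 2 * \<bar>y\<bar>)\<^sup>2 \<le> 1 + 6 * p * y\<^sup>2"
      by (simp add: power2_eq_square algebra_simps abs_mult_self_eq)
  qed (use p in auto)
  finally have "\<bar>1 + y\<bar> powr p + p * \<bar>y\<bar> \<le> (1 + 6 * p * y\<^sup>2) powr (p / 2)" .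
  moreover have "- (p * \<bar>y\<bar>) \<le> p * y" using p mult_left_mono[of "-\<bar>y\<bar>" y p] by simp
  ultimately show ?thesis by simp
qed

text \<open>Scaling by \<open>x\<close> reduces this to the previous bound. The coefficient of
  \<open>y\<close> is the derivative of \<open>\<bar>x\<bar> powr p\<close>.\<close>

lemma abs_add_powr_le:
  fixes x y p :: real
  assumes p: "2 \<le> p"
  shows "\<bar>x + y\<bar> powr p \<le> p * (sgn x * \<bar>x\<bar> powr (p - 1)) * y + (x\<^sup>2 + 6 * p * y\<^sup>2) powr (p / 2)"
proof (cases "x = 0")
  case True
  have "\<bar>y\<bar> powr p = (y\<^sup>2) powr (p / 2)" by (rule abs_powr_eq_power2_powr)
  also have "\<dots> \<le> (6 * p * y\<^sup>2) powr (p / 2)"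
    using p mult_right_mono[of 1 "6 * p" "y\<^sup>2"] by (intro powr_mono2) auto
  finally show ?thesis using True by simp
next
  case False
  have "x + y = x * (1 + y / x)" using False by (simp add: field_simps)
  then have "\<bar>x + y\<bar> powr p = \<bar>x\<bar> powr p * \<bar>1 + y / x\<bar> powr p"
    by (simp add: powr_mult abs_mult)
  also have "\<dots> \<le> \<bar>x\<bar> powr p * (p * (y / x) + (1 + 6 * p * (y / x)\<^sup>2) powr (p / 2))"
    using p by (intro mult_left_mono abs_one_add_powr_le) auto
  also have "\<dots> = \<bar>x\<bar> powr p * (p * (y / x)) + \<bar>x\<bar> powr p * (1 + 6 * p * (y / x)\<^sup>2) powr (p / 2)"
    by (rule distrib_left)
  also have "\<bar>x\<bar> powr p * (p * (y / x)) = p * (sgn x * \<bar>x\<bar> powr (p - 1)) * y"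
    using False by (simp add: powr_diff sgn_real_def)
  also have "\<bar>x\<bar> powr p * (1 + 6 * p * (y / x)\<^sup>2) powr (p / 2) = (x\<^sup>2 + 6 * p * y\<^sup>2) powr (p / 2)"
  proof -
    have "\<bar>x\<bar> powr p = (x\<^sup>2) powr (p / 2)" by (rule abs_powr_eq_power2_powr)
    moreover have "x\<^sup>2 * (1 + 6 * p * (y / x)\<^sup>2) = x\<^sup>2 + 6 * p * y\<^sup>2"
      using False by (simp add: field_simps)
    ultimately show ?thesis using p by (simp add: powr_mult[symmetric])
  qed
  finally show ?thesis .
qed


section \<open>The two-point inequality for exponents between 1 and 2\<close>

lemma powr_mean_ge_quadratic:
  fixes s b :: real
  assumes s: "1 < s" "s \<le> 2" and b: "0 \<le> b" "b \<le> 1"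
  shows "1 + s * (s - 1) / 2 * b\<^sup>2 \<le> ((1 + b) powr s + (1 - b) powr s) / 2"
proof -
  have *: "1 - a * x \<le> (1 + x) powr (- a)" if "-1 < x" "0 \<le> a" for a x :: real
  proof -
    have "a * ln (1 + x) \<le> a * x" using that ln_add_one_self_le_self2[of x] by (intro mult_left_mono) auto
    then have "1 - a * x \<le> 1 + (- a * ln (1 + x))" by simp
    also have "\<dots> \<le> exp (- a * ln (1 + x))" by (rule exp_ge_add_one_self)
    finally show ?thesis using that by (simp add: powr_def)
  qed
  \<comment> \<open>Up to the factor \<open>s / 2\<close> this is the derivative of
    \<open>g\<close>, the difference of the two sides up to a constant. Its own derivative is
    nonnegative because the bounds \<open>*\<close> at \<open>y\<close> and at \<open>- y\<close>
    add up to 2.\<close>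
  define h where "h = (\<lambda>x. (1 + x) powr (s - 1) - (1 - x) powr (s - 1) - 2 * (s - 1) * x)"
  have h: "0 \<le> h x" if "0 \<le> x" "x < 1" for x
  proof -
    have "h 0 \<le> h x"
    proof (rule DERIV_nonneg_imp_nondecreasing[OF that(1)])
      fix y assume y: "0 \<le> y" "y \<le> x"
      then have "y < 1" using that by simp
      then have "(h has_real_derivative (s - 1) * ((1 + y) powr (s - 2) + (1 - y) powr (s - 2) - 2)) (at y)"
        using y s unfolding h_def by (auto intro!: derivative_eq_intros simp: algebra_simps)
      moreover have "0 \<le> (s - 1) * ((1 + y) powr (s - 2) + (1 - y) powr (s - 2) - 2)"
        using *[of y "2 - s"] *[of "- y" "2 - s"] s y \<open>y < 1\<close> by (intro mult_nonneg_nonneg) auto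
      ultimately show "\<exists>D. (h has_real_derivative D) (at y) \<and> 0 \<le> D" by blast
    qed
    then show ?thesis by (simp add: h_def)
  qed
  define g where "g = (\<lambda>x. ((1 + x) powr s + (1 - x) powr s) / 2 - s * (s - 1) / 2 * x\<^sup>2)"
  have "g 0 \<le> g b"
  \<comment> \<open>For \<open>b = 1\<close> the base \<open>1 - x\<close> vanishes at the right
    end, so derivatives are taken only in the interior and continuity covers the end points.\<close>
  proof (rule DERIV_nonneg_imp_increasing_open[OF b(1)])
    fix y assume y: "0 < y" "y < b"
    then have "y < 1" using b by simp
    then have "(g has_real_derivative s / 2 * h y) (at y)"
      using y s unfolding h_def g_def
      by (auto intro!: derivative_eq_intros simp: algebra_simps add_divide_distrib diff_divide_distrib)
    moreover have "0 \<le> s / 2 * h y" using h y s \<open>y < 1\<close> by auto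
    ultimately show "\<exists>D. (g has_real_derivative D) (at y) \<and> 0 \<le> D" by blast
  next
    show "continuous_on {0..b} g"
      unfolding g_def using s b by (intro continuous_intros continuous_on_powr') auto
  qed
  then show ?thesis by (simp add: g_def field_simps)
qed

text \<open>After scaling to \<open>a = 1\<close>, both sides are compared with
  \<open>1 + s * (s - 1) / 2 * c^2\<close>: the left one by concavity of the power
  \<open>s / 2\<close>, the right one by the preceding lemma. This is the scalar case of the
  Ball-Carlen-Lieb inequality.\<close>

lemma two_point_inequality:
  fixes a b s :: real
  assumes s: "1 < s" "s \<le> 2"
  shows "(a\<^sup>2 + (s - 1) * b\<^sup>2) powr (s / 2) \<le> (\<bar>a + b\<bar> powr s + \<bar>a - b\<bar> powr s) / 2"
proof -
  have le: "(a\<^sup>2 + (s - 1) * b\<^sup>2) powr (s / 2) \<le> (\<bar>a + b\<bar> powr s + \<bar>a - b\<bar> powr s) / 2"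
    if ab: "0 \<le> b" "b \<le> a" for a b :: real
  proof (cases "a = 0")
    case True
    then show ?thesis using ab by simp
  next
    case False
    then have a: "0 < a" using ab by simp
    define c where "c = b / a"
    have c: "0 \<le> c" "c \<le> 1" "b = c * a" using a ab by (auto simp: c_def)
    have "(1 + (s - 1) * c\<^sup>2) powr (s / 2) \<le> 1 + s * (s - 1) / 2 * c\<^sup>2"
    proof -
      have "(1 + (s - 1) * c\<^sup>2) powr (s / 2) * 1 powr (1 - s / 2)
          \<le> s / 2 * (1 + (s - 1) * c\<^sup>2) + (1 - s / 2) * 1"
        using s by (intro Youngs_inequality_0) (auto intro!: add_pos_nonneg)
      then show ?thesis by (simp add: field_simps)
    qed
    also have "\<dots> \<le> ((1 + c) powr s + (1 - c) powr s) / 2"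
      using s c by (intro powr_mean_ge_quadratic)
    finally have "a powr s * (1 + (s - 1) * c\<^sup>2) powr (s / 2) \<le> a powr s * (((1 + c) powr s + (1 - c) powr s) / 2)"
      using a by (intro mult_left_mono) auto
    moreover have "a powr s * (1 + (s - 1) * c\<^sup>2) powr (s / 2) = (a\<^sup>2 + (s - 1) * b\<^sup>2) powr (s / 2)"
    proof -
      have "a powr s = (a\<^sup>2) powr (s / 2)" using abs_powr_eq_power2_powr[of a s] a by simp
      moreover have "a\<^sup>2 * (1 + (s - 1) * c\<^sup>2) = a\<^sup>2 + (s - 1) * b\<^sup>2"
        using c(3) by (simp add: algebra_simps power_mult_distrib)
      ultimately show ?thesis by (simp only: powr_mult[symmetric])
    qed
    moreover have "\<bar>a + b\<bar> powr s = a powr s * (1 + c) powr s"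
    proof -
      have "\<bar>a + b\<bar> = a * (1 + c)" using a ab c(3) by (simp add: algebra_simps)
      then show ?thesis by (simp only: powr_mult)
    qed
    moreover have "\<bar>a - b\<bar> powr s = a powr s * (1 - c) powr s"
    proof -
      have "\<bar>a - b\<bar> = a * (1 - c)" using a ab c(3) by (simp add: algebra_simps)
      then show ?thesis by (simp only: powr_mult)
    qed
    ultimately show ?thesis by (simp add: algebra_simps)
  qed
  have eq: "\<bar>\<bar>a\<bar> + \<bar>b\<bar>\<bar> powr s + \<bar>\<bar>a\<bar> - \<bar>b\<bar>\<bar> powr s = \<bar>a + b\<bar> powr s + \<bar>a - b\<bar> powr s"
  proof -
    have "(\<bar>\<bar>a\<bar> + \<bar>b\<bar>\<bar> = \<bar>a + b\<bar> \<and> \<bar>\<bar>a\<bar> - \<bar>b\<bar>\<bar> = \<bar>a - b\<bar>) \<or>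
      (\<bar>\<bar>a\<bar> + \<bar>b\<bar>\<bar> = \<bar>a - b\<bar> \<and> \<bar>\<bar>a\<bar> - \<bar>b\<bar>\<bar> = \<bar>a + b\<bar>)"
      by arith
    then show ?thesis by auto
  qed
  show ?thesis
  proof (cases "\<bar>b\<bar> \<le> \<bar>a\<bar>")
    case True
    then show ?thesis using le[of "\<bar>b\<bar>" "\<bar>a\<bar>"] eq by simp
  next
    case False
    \<comment> \<open>Since \<open>s - 1 \<le> 1\<close>, giving the full weight to the larger
      number only raises the left side, while the right side is symmetric.\<close>
    have "(s - 1) * b\<^sup>2 + a\<^sup>2 \<le> (s - 1) * a\<^sup>2 + b\<^sup>2"
    proof -
      have "(2 - s) * a\<^sup>2 \<le> (2 - s) * b\<^sup>2"
        using s False abs_le_square_iff[of a b] by (intro mult_left_mono) auto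
      then show ?thesis by (simp add: algebra_simps)
    qed
    then have "(a\<^sup>2 + (s - 1) * b\<^sup>2) powr (s / 2) \<le> (b\<^sup>2 + (s - 1) * a\<^sup>2) powr (s / 2)"
      using s by (intro powr_mono2) (auto simp: add.commute)
    also have "\<dots> \<le> (\<bar>\<bar>b\<bar> + \<bar>a\<bar>\<bar> powr s + \<bar>\<bar>b\<bar> - \<bar>a\<bar>\<bar> powr s) / 2"
      using le[of "\<bar>a\<bar>" "\<bar>b\<bar>"] False by simp
    also have "\<dots> = (\<bar>a + b\<bar> powr s + \<bar>a - b\<bar> powr s) / 2"
      using eq by (simp add: add.commute abs_minus_commute)
    finally show ?thesis .
  qed
qed

section \<open>The norms \<open>lq_norm\<close>\<close>

text \<open>The weights \<open>A / (A + B)\<close> and \<open>B / (A + B)\<close> make the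
  coordinatewise concavity bounds sum to exactly \<open>(A + B) powr r\<close>. Here
  \<open>A\<close> and \<open>B\<close> are the l^r functionals of \<open>u\<close> and
  \<open>w\<close>, given implicitly through their \<open>r\<close>-th powers.\<close>

lemma powr_sum_reverse_Minkowski:
  fixes u w :: "'i \<Rightarrow> real"
  assumes fin: "finite I" and u: "\<And>i. i \<in> I \<Longrightarrow> 0 \<le> u i" and w: "\<And>i. i \<in> I \<Longrightarrow> 0 \<le> w i"
    and r: "0 < r" "r \<le> 1"
    and A: "0 \<le> A" "A powr r = (\<Sum>i\<in>I. u i powr r)"
    and B: "0 \<le> B" "B powr r = (\<Sum>i\<in>I. w i powr r)"
  shows "(A + B) powr r \<le> (\<Sum>i\<in>I. (u i + w i) powr r)"
proof -
  consider "A = 0" | "B = 0" | "0 < A" "0 < B" using A B by linarith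
  then show ?thesis
  proof cases
    case 1
    then have "(A + B) powr r = (\<Sum>i\<in>I. w i powr r)" using B by simp
    also have "\<dots> \<le> (\<Sum>i\<in>I. (u i + w i) powr r)"
      using u w r by (intro sum_mono powr_mono2) auto
    finally show ?thesis .
  next
    case 2
    then have "(A + B) powr r = (\<Sum>i\<in>I. u i powr r)" using A by simp
    also have "\<dots> \<le> (\<Sum>i\<in>I. (u i + w i) powr r)"
      using u w r by (intro sum_mono powr_mono2) auto
    finally show ?thesis .
  next
    case 3
    let ?\<alpha> = "A / (A + B)" and ?\<beta> = "B / (A + B)"
    have \<alpha>\<beta>: "0 < ?\<alpha>" "0 < ?\<beta>" "?\<alpha> + ?\<beta> = 1" using 3 by (auto simp: add_divide_distrib[symmetric])
    have *: "(c / k) powr (1 - r) * c powr r = c * k powr (r - 1)" if "0 < c" "0 < k" for c k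
      using that by (simp add: powr_divide powr_diff)
    have "(A + B) powr r = (A + B) * (A + B) powr (r - 1)"
      using 3 by (simp add: powr_diff)
    also have "\<dots> = A * (A + B) powr (r - 1) + B * (A + B) powr (r - 1)"
      by (rule distrib_right)
    also have "\<dots> = ?\<alpha> powr (1 - r) * A powr r + ?\<beta> powr (1 - r) * B powr r"
      using 3 by (simp add: *)
    also have "\<dots> = (\<Sum>i\<in>I. ?\<alpha> powr (1 - r) * u i powr r + ?\<beta> powr (1 - r) * w i powr r)"
      unfolding A B by (simp add: sum.distrib sum_distrib_left)
    also have "\<dots> \<le> (\<Sum>i\<in>I. (u i + w i) powr r)"
      using u w r \<alpha>\<beta> by (intro sum_mono powr_add_ge_weighted) auto
    finally show ?thesis .
  qed
qed

section \<open>Scaling, monotonicity in the exponent and Hoelder's inequality\<close>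

lemma lq_norm_nonneg: "0 \<le> lq_norm d q x"
  by (simp add: lq_norm_def)

lemma lq_norm_powr: "0 < q \<Longrightarrow> lq_norm d q x powr q = (\<Sum>i<d. \<bar>x i\<bar> powr q)"
  by (simp add: lq_norm_def powr_powr sum_nonneg)

lemma lq_norm_scaleR: "0 < q \<Longrightarrow> lq_norm d q (c *\<^sub>R x) = \<bar>c\<bar> * lq_norm d q x"
  by (simp add: lq_norm_def scaleR_fun_def abs_mult powr_mult powr_powr flip: sum_distrib_left)

lemma lq_norm_minus_commute: "lq_norm d q (x - y) = lq_norm d q (y - x)"
  by (simp add: lq_norm_def abs_minus_commute)

lemma abs_le_lq_norm:
  assumes "0 < q" "i < d"
  shows "\<bar>x i\<bar> \<le> lq_norm d q x"
proof -
  have "\<bar>x i\<bar> powr q \<le> (\<Sum>i<d. \<bar>x i\<bar> powr q)"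
    using assms by (intro member_le_sum[of i "{..<d}" "\<lambda>i. \<bar>x i\<bar> powr q"]) auto
  then have "(\<bar>x i\<bar> powr q) powr (1 / q) \<le> (\<Sum>i<d. \<bar>x i\<bar> powr q) powr (1 / q)"
    using assms by (intro powr_mono2) auto
  then show ?thesis using assms by (simp add: lq_norm_def powr_powr)
qed

text \<open>Once \<open>lq_norm d q' x\<close> is scaled to 1, all coordinates have modulus at most
  1, so their powers decrease as the exponent grows.\<close>

lemma lq_norm_antimono:
  assumes "0 < q'" "q' \<le> q"
  shows "lq_norm d q x \<le> lq_norm d q' x"
proof (cases "lq_norm d q' x = 0")
  case True
  then have "\<bar>x i\<bar> = 0" if "i < d" for i using abs_le_lq_norm[of q' i d x] that assms by auto
  then show ?thesis using True by (simp add: lq_norm_def)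
next
  case False
  let ?n = "lq_norm d q' x"
  have n: "0 < ?n" using False lq_norm_nonneg[of d q' x] by linarith
  have "(\<Sum>i<d. \<bar>x i\<bar> powr q) / ?n powr q = (\<Sum>i<d. (\<bar>x i\<bar> / ?n) powr q)"
    by (simp add: powr_divide sum_divide_distrib)
  also have "\<dots> \<le> (\<Sum>i<d. (\<bar>x i\<bar> / ?n) powr q')"
    using assms n abs_le_lq_norm[of q' _ d x] by (intro sum_mono powr_mono') (auto simp: divide_le_eq)
  also have "\<dots> = (\<Sum>i<d. \<bar>x i\<bar> powr q') / ?n powr q'"
    by (simp add: powr_divide sum_divide_distrib)
  also have "\<dots> = 1" using assms n by (simp add: lq_norm_powr[symmetric])
  finally have "(\<Sum>i<d. \<bar>x i\<bar> powr q) \<le> ?n powr q" using n by (simp add: divide_le_eq)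
  then have "(\<Sum>i<d. \<bar>x i\<bar> powr q) powr (1 / q) \<le> (?n powr q) powr (1 / q)"
    using assms by (intro powr_mono2) (auto intro: sum_nonneg)
  then show ?thesis using assms n by (simp add: lq_norm_def powr_powr)
qed

lemma dot_Hoelder:
  assumes "1 < p" "1 < p'" "1 / p + 1 / p' = 1"
  shows "dot d x y \<le> lq_norm d p x * lq_norm d p' y"
proof (cases "lq_norm d p x = 0 \<or> lq_norm d p' y = 0")
  case True
  then have "x i * y i = 0" if "i < d" for i
    using abs_le_lq_norm[of p i d x] abs_le_lq_norm[of p' i d y] that assms by auto
  then have "dot d x y = 0" unfolding dot_def by (intro sum.neutral) simp
  then show ?thesis using True by auto
next
  case False
  let ?a = "lq_norm d p x" and ?b = "lq_norm d p' y"
  have ab: "0 < ?a" "0 < ?b" using False lq_norm_nonneg[of d p x] lq_norm_nonneg[of d p' y] by auto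
  have "dot d x y / (?a * ?b) = (\<Sum>i<d. (x i / ?a) * (y i / ?b))"
    by (simp add: dot_def sum_divide_distrib)
  also have "\<dots> \<le> (\<Sum>i<d. (\<bar>x i\<bar> / ?a) powr p / p + (\<bar>y i\<bar> / ?b) powr p' / p')"
  proof (rule sum_mono)
    fix i
    have "(x i / ?a) * (y i / ?b) \<le> (\<bar>x i\<bar> / ?a) * (\<bar>y i\<bar> / ?b)"
      using ab abs_ge_self[of "x i * y i"] by (simp add: divide_right_mono abs_mult)
    also have "\<dots> \<le> (\<bar>x i\<bar> / ?a) powr p / p + (\<bar>y i\<bar> / ?b) powr p' / p'"
      using ab assms by (intro Youngs_inequality) auto
    finally show "(x i / ?a) * (y i / ?b) \<le> (\<bar>x i\<bar> / ?a) powr p / p + (\<bar>y i\<bar> / ?b) powr p' / p'" .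
  qed
  also have "\<dots> = (\<Sum>i<d. \<bar>x i\<bar> powr p) / ?a powr p / p + (\<Sum>i<d. \<bar>y i\<bar> powr p') / ?b powr p' / p'"
    by (simp add: powr_divide sum.distrib sum_divide_distrib)
  also have "\<dots> = 1" using assms ab by (simp add: lq_norm_powr[symmetric])
  finally show ?thesis using ab by (simp add: divide_le_eq)
qed

text \<open>The reverse Minkowski inequality lifts the two-point inequality from numbers to vectors.\<close>

lemma lq_norm_uniformly_convex:
  assumes s: "1 < s" "s \<le> 2"
  shows "(lq_norm d s a)\<^sup>2 + (s - 1) * (lq_norm d s b)\<^sup>2
    \<le> ((lq_norm d s (a + b))\<^sup>2 + (lq_norm d s (a - b))\<^sup>2) / 2"
proof -
  let ?n = "lq_norm d s" and ?r = "s / 2"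
  \<comment> \<open>The squared norm is the l^r functional, with \<open>r = s / 2\<close>, of the
    squared coordinates; this is what makes reverse Minkowski applicable.\<close>
  have sq: "((?n x)\<^sup>2) powr ?r = (\<Sum>i<d. \<bar>x i\<bar> powr s)" for x
    using abs_powr_eq_power2_powr[of "?n x" s] lq_norm_powr[of s d x] lq_norm_nonneg[of d s x] s by simp
  have "((?n a)\<^sup>2 + (s - 1) * (?n b)\<^sup>2) powr ?r \<le> (\<Sum>i<d. ((a i)\<^sup>2 + (s - 1) * (b i)\<^sup>2) powr ?r)"
  proof (rule powr_sum_reverse_Minkowski)
    show "((?n a)\<^sup>2) powr ?r = (\<Sum>i<d. ((a i)\<^sup>2) powr ?r)"
      unfolding sq by (simp add: abs_powr_eq_power2_powr)
    show "((s - 1) * (?n b)\<^sup>2) powr ?r = (\<Sum>i<d. ((s - 1) * (b i)\<^sup>2) powr ?r)"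
      unfolding powr_mult sq by (simp add: abs_powr_eq_power2_powr sum_distrib_left)
  qed (use s in auto)
  also have "\<dots> \<le> (\<Sum>i<d. (\<bar>a i + b i\<bar> powr s + \<bar>a i - b i\<bar> powr s) / 2)"
    using s by (intro sum_mono two_point_inequality)
  also have "\<dots> = (1 / 2) * ((?n (a + b))\<^sup>2) powr ?r + (1 / 2) * ((?n (a - b))\<^sup>2) powr ?r"
    unfolding sq by (simp add: sum.distrib add_divide_distrib sum_divide_distrib)
  finally have "(((?n a)\<^sup>2 + (s - 1) * (?n b)\<^sup>2) powr ?r) powr (1 / ?r)
      \<le> ((1 / 2) * ((?n (a + b))\<^sup>2) powr ?r + (1 / 2) * ((?n (a - b))\<^sup>2) powr ?r) powr (1 / ?r)"
    using s by (intro powr_mono2) auto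
  \<comment> \<open>The exponent \<open>1 / ?r = 2 / s\<close> is at least 1, so convexity of this
    power leads back from \<open>s\<close>-th powers to squared norms.\<close>
  also have "\<dots> \<le> (1 / 2) * (((?n (a + b))\<^sup>2) powr ?r) powr (1 / ?r)
      + (1 / 2) * (((?n (a - b))\<^sup>2) powr ?r) powr (1 / ?r)"
    using s by (intro powr_convex_combination_le) auto
  finally show ?thesis using s by (simp add: powr_powr)
qed

text \<open>Uniform convexity is a midpoint statement, so the step \<open>t\<close> is halved
  repeatedly, applying it to \<open>e\<close> and \<open>e + t *\<^sub>R (h - e)\<close>. Dyadic
  steps suffice because only the limit \<open>t\<close> to 0 is taken later.\<close>

lemma lq_norm_strongly_convex_dyadic:
  fixes k :: nat
  assumes s: "1 < s" "s \<le> 2"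
  defines "t \<equiv> 1 / 2 ^ k"
  shows "(lq_norm d s (e + t *\<^sub>R (h - e)))\<^sup>2
    \<le> (1 - t) * (lq_norm d s e)\<^sup>2 + t * (lq_norm d s h)\<^sup>2 - (s - 1) * t * (1 - t) * (lq_norm d s (h - e))\<^sup>2"
  unfolding t_def
proof (induction k)
  case 0
  then show ?case by simp
next
  case (Suc k)
  define t :: real where "t = 1 / 2 ^ k"
  let ?n = "\<lambda>x. (lq_norm d s x)\<^sup>2"
  let ?b = "(t / 2) *\<^sub>R (h - e)"
  have uc: "?n (e + ?b) + (s - 1) * ?n ?b \<le> (?n (e + ?b + ?b) + ?n (e + ?b - ?b)) / 2"
    by (rule lq_norm_uniformly_convex[OF s])
  have p: "e + ?b + ?b = e + t *\<^sub>R (h - e)" by (simp add: scaleR_add_left[symmetric] add.assoc)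
  have m: "e + ?b - ?b = e" by simp
  have b: "?n ?b = t\<^sup>2 / 4 * ?n (h - e)"
    using s by (simp add: lq_norm_scaleR power_mult_distrib power_divide)
  have "?n (e + ?b) \<le> (?n (e + t *\<^sub>R (h - e)) + ?n e) / 2 - (s - 1) * (t\<^sup>2 / 4) * ?n (h - e)"
    using uc unfolding p m b by (simp only: mult.assoc)
  also have "\<dots> \<le> (((1 - t) * ?n e + t * ?n h - (s - 1) * t * (1 - t) * ?n (h - e)) + ?n e) / 2
      - (s - 1) * (t\<^sup>2 / 4) * ?n (h - e)"
    by (intro diff_right_mono divide_right_mono add_right_mono Suc.IH[folded t_def]) simp
  \<comment> \<open>The quadratic gains add up exactly:
    \<open>t * (1 - t) / 2 + t^2 / 4 = (t / 2) * (1 - t / 2)\<close>.\<close>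
  also have "\<dots> = (1 - t / 2) * ?n e + t / 2 * ?n h - (s - 1) * (t / 2) * (1 - t / 2) * ?n (h - e)"
    by (simp add: field_simps power2_eq_square)
  finally show ?case by (simp add: t_def mult.commute fun_diff_def plus_fun_def)
qed

lemma regularizer_strongly_convex_dyadic:
  fixes k :: nat
  assumes s: "1 < s" "s \<le> 2"
  defines "t \<equiv> 1 / 2 ^ k"
  shows "regularizer d s x0 (e + t *\<^sub>R (h - e))
    \<le> (1 - t) * regularizer d s x0 e + t * regularizer d s x0 h
      - (s - 1) / 2 * t * (1 - t) * (lq_norm d s (h - e))\<^sup>2"
proof -
  have "e + t *\<^sub>R (h - e) - x0 = (e - x0) + t *\<^sub>R ((h - x0) - (e - x0))" by simp
  then show ?thesis
    using lq_norm_strongly_convex_dyadic[OF s, of d "e - x0" k "h - x0"]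
    unfolding regularizer_def t_def by (simp add: field_simps)
qed

section \<open>Topology and measurability of the sequence model\<close>

lemma continuous_on_lq_norm:
  assumes "0 < q"
  shows "continuous_on UNIV (\<lambda>x. lq_norm d q (x - c))"
  using assms unfolding lq_norm_def fun_diff_def
  by (intro continuous_on_powr' continuous_intros) (auto intro: sum_nonneg)

lemma borel_measurable_lq_norm:
  "0 < q \<Longrightarrow> (\<lambda>x. lq_norm d q (x - c)) \<in> borel_measurable borel"
  by (intro borel_measurable_continuous_onI continuous_on_lq_norm)

lemma tendsto_rvec_iff: "(u \<longlongrightarrow> x) F \<longleftrightarrow> (\<forall>i. ((\<lambda>n. u n i) \<longlongrightarrow> x i) F)" for x :: rvec
proof -
  have "(u \<longlongrightarrow> x) F \<longleftrightarrow> limitin (powertop_real UNIV) u x F"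
    by (simp add: euclidean_product_topology)
  also have "\<dots> \<longleftrightarrow> (\<forall>i. ((\<lambda>n. u n i) \<longlongrightarrow> x i) F)"
    by (simp add: limitin_componentwise)
  finally show ?thesis .
qed

lemma Rn_iff: "x \<in> Rn d \<longleftrightarrow> (\<forall>i\<ge>d. x i = 0)"
  by (simp add: Rn_def topspace_Euclidean_space)

text \<open>Open sets come from the product topology, whereas \<open>has_gradient\<close> speaks of
  Euclidean balls. Points outside \<open>U\<close> at norm distance tending to 0 would converge to
  \<open>z\<close> in each coordinate, those from \<open>d\<close> on being zero, against
  openness.\<close>

lemma openin_Euclidean_space_contains_ball:
  assumes U: "openin (Euclidean_space d) U" and z: "z \<in> U"
  shows "\<exists>r>0. \<forall>y\<in>Rn d. lq_norm d 2 (y - z) < r \<longrightarrow> y \<in> U"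
proof (rule ccontr)
  assume "\<not> ?thesis"
  then have "\<forall>n. \<exists>y\<in>Rn d. lq_norm d 2 (y - z) < 1 / real (Suc n) \<and> y \<notin> U"
    by (auto simp del: of_nat_Suc)
  then obtain y where y: "\<And>n. y n \<in> Rn d" "\<And>n. lq_norm d 2 (y n - z) < 1 / real (Suc n)" "\<And>n. y n \<notin> U"
    by metis
  obtain T where T: "open T" "U = T \<inter> Rn d"
    using U unfolding Euclidean_space_def openin_subtopology Rn_def topspace_Euclidean_space
    by (auto simp: euclidean_product_topology)
  have "(\<lambda>n. y n i) \<longlonglongrightarrow> z i" for i
  proof (cases "i < d")
    case True
    have "\<bar>y n i - z i\<bar> \<le> 1 / real (Suc n)" for n
      using abs_le_lq_norm[of 2 i d "y n - z"] True y(2)[of n] by simp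
    then have "(\<lambda>n. y n i - z i) \<longlonglongrightarrow> 0"
      by (intro Lim_null_comparison[OF _ LIMSEQ_inverse_real_of_nat])
        (auto simp: inverse_eq_divide simp del: of_nat_Suc)
    then show ?thesis by (simp add: LIM_zero_iff)
  next
    case False
    then show ?thesis using y(1) z T by (simp add: Rn_iff)
  qed
  then have "y \<longlonglongrightarrow> z" by (simp add: tendsto_rvec_iff)
  then have "\<forall>\<^sub>F n in sequentially. y n \<in> T" using T z by (auto dest: topological_tendstoD)
  then obtain n where "y n \<in> T" by (auto simp: eventually_sequentially)
  then show False using y T by auto
qed

section \<open>Moments of sums of independent random variables\<close>

context prob_space
begin

lemma integrable_powr_smaller:
  fixes Y :: "'a \<Rightarrow> real"
  assumes "integrable M (\<lambda>w. \<bar>Y w\<bar> powr p)" "Y \<in> borel_measurable M" "0 \<le> r" "r \<le> p"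
  shows "integrable M (\<lambda>w. \<bar>Y w\<bar> powr r)"
proof (rule Bochner_Integration.integrable_bound)
  show "integrable M (\<lambda>w. 1 + \<bar>Y w\<bar> powr p)" using assms(1) by simp
  have "\<bar>y\<bar> powr r \<le> 1 + \<bar>y\<bar> powr p" for y :: real
  proof (cases "\<bar>y\<bar> \<le> 1")
    case True
    then have "\<bar>y\<bar> powr r \<le> 1 powr r" using assms by (intro powr_mono2) auto
    then show ?thesis by (smt (verit) powr_one_eq_one powr_ge_zero)
  next
    case False
    then have "\<bar>y\<bar> powr r \<le> \<bar>y\<bar> powr p" using assms by (intro powr_mono) auto
    then show ?thesis by simp
  qed
  then show "AE w in M. norm (\<bar>Y w\<bar> powr r) \<le> norm (1 + \<bar>Y w\<bar> powr p)"
    by simp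
qed (use assms(2) in measurable)

lemma integrable_add_powr:
  fixes X Y :: "'a \<Rightarrow> real"
  assumes "integrable M (\<lambda>w. \<bar>X w\<bar> powr p)" "integrable M (\<lambda>w. \<bar>Y w\<bar> powr p)"
    and [measurable]: "X \<in> borel_measurable M" "Y \<in> borel_measurable M" and p: "1 \<le> p"
  shows "integrable M (\<lambda>w. \<bar>X w + Y w\<bar> powr p)"
proof (rule Bochner_Integration.integrable_bound)
  show "integrable M (\<lambda>w. (1/2) powr (1 - p) * \<bar>X w\<bar> powr p + (1/2) powr (1 - p) * \<bar>Y w\<bar> powr p)"
    using assms(1,2) by auto
  have "\<bar>x + y\<bar> powr p \<le> (1/2) powr (1 - p) * \<bar>x\<bar> powr p + (1/2) powr (1 - p) * \<bar>y\<bar> powr p" for x y :: real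
  proof -
    have "\<bar>x + y\<bar> powr p \<le> (\<bar>x\<bar> + \<bar>y\<bar>) powr p" using p by (intro powr_mono2) auto
    also have "\<dots> \<le> (1/2) powr (1 - p) * \<bar>x\<bar> powr p + (1/2) powr (1 - p) * \<bar>y\<bar> powr p"
      using p by (intro powr_add_le_weighted) auto
    finally show ?thesis .
  qed
  then show "AE w in M. norm (\<bar>X w + Y w\<bar> powr p)
      \<le> norm ((1/2) powr (1 - p) * \<bar>X w\<bar> powr p + (1/2) powr (1 - p) * \<bar>Y w\<bar> powr p)"
    by simp
qed measurable

text \<open>
  Jensen's inequality with weights \<open>n / (n + 1)\<close> and \<open>1 / (n + 1)\<close> replaces Minkowski's inequality
  in \<open>L\<^sup>p\<^sup>/\<^sup>2\<close> in the induction step, and the first-order term vanishes by independence.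
\<close>

lemma sum_indep_moment_bound:
  fixes Y :: "nat \<Rightarrow> 'a \<Rightarrow> real"
  assumes "indep_vars (\<lambda>_. borel) Y {..<n}" and p: "2 \<le> p" and m: "0 \<le> m"
    and "\<And>j. j < n \<Longrightarrow> integrable M (\<lambda>w. \<bar>Y j w\<bar> powr p)"
    and "\<And>j. j < n \<Longrightarrow> expectation (Y j) = 0"
    and "\<And>j. j < n \<Longrightarrow> expectation (\<lambda>w. \<bar>Y j w\<bar> powr p) \<le> m"
  shows "integrable M (\<lambda>w. \<bar>\<Sum>j<n. Y j w\<bar> powr p) \<and>
    expectation (\<lambda>w. \<bar>\<Sum>j<n. Y j w\<bar> powr p) \<le> (6 * p * n) powr (p / 2) * m"
  using assms(1,4-6)
proof (induction n)
  case 0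
  then show ?case by simp
next
  case (Suc n)
  have Yn: "integrable M (\<lambda>w. \<bar>Y n w\<bar> powr p)" "expectation (Y n) = 0"
    "expectation (\<lambda>w. \<bar>Y n w\<bar> powr p) \<le> m"
    using Suc.prems by auto
  have meas[measurable]: "Y j \<in> borel_measurable M" if "j \<le> n" for j
    using Suc.prems(1) that unfolding indep_vars_def by auto
  show ?case
  proof (cases "n = 0")
    \<comment> \<open>The weights used below must be positive, so a single summand is treated apart,
      with \<open>6 * p \<ge> 1\<close>.\<close>
    case True
    have "1 powr (p / 2) * m \<le> (6 * p) powr (p / 2) * m"
      using p m by (intro mult_right_mono powr_mono2) auto
    then show ?thesis using Yn True by simp
  next
    case False
    define X where "X w = (\<Sum>j<n. Y j w)" for w
    have X[measurable]: "X \<in> borel_measurable M" unfolding X_def by measurable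
    have "indep_vars (\<lambda>_. borel) Y {..<n}"
      using Suc.prems(1) by (rule indep_vars_subset) auto
    then have IH: "integrable M (\<lambda>w. \<bar>X w\<bar> powr p)"
      "expectation (\<lambda>w. \<bar>X w\<bar> powr p) \<le> (6 * p * n) powr (p / 2) * m"
      using Suc.IH Suc.prems unfolding X_def by auto
    have ind: "indep_var borel (Y n) borel X"
      using Suc.prems(1) unfolding X_def by (intro indep_vars_sum) (auto simp: lessThan_Suc)
    \<comment> \<open>Up to the factor \<open>p\<close> this is the derivative of
      \<open>\<bar>x\<bar> powr p\<close>. At the partial sum it is independent of
      \<open>Y n\<close>, whose mean is zero, so the product has mean zero.\<close>
    define \<phi> :: "real \<Rightarrow> real" where "\<phi> x = sgn x * \<bar>x\<bar> powr (p - 1)" for x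
    have [measurable]: "\<phi> \<in> borel_measurable borel" unfolding \<phi>_def by measurable
    have ind': "indep_var borel (Y n) borel (\<lambda>w. \<phi> (X w))"
      using indep_var_compose[OF ind, of id borel \<phi> borel] by (simp add: comp_def)
    have int_Y: "integrable M (Y n)"
    proof (rule integrable_abs_cancel)
      show "integrable M (\<lambda>w. \<bar>Y n w\<bar>)"
        using integrable_powr_smaller[OF Yn(1) meas, of 1] p by simp
    qed simp
    have int_\<phi>: "integrable M (\<lambda>w. \<phi> (X w))"
    proof (rule Bochner_Integration.integrable_bound)
      show "integrable M (\<lambda>w. \<bar>X w\<bar> powr (p - 1))"
        using integrable_powr_smaller[OF IH(1) X, of "p - 1"] p by simp
    qed (auto simp: \<phi>_def abs_mult sgn_real_def)
    have cross: "integrable M (\<lambda>w. Y n w * \<phi> (X w))" "expectation (\<lambda>w. Y n w * \<phi> (X w)) = 0"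
      using indep_var_integrable[OF ind' int_Y int_\<phi>] indep_var_lebesgue_integral[OF ind' int_Y int_\<phi>] Yn(2)
      by auto
    define r where "r = p / 2"
    \<comment> \<open>With these weights the contributions of the first \<open>n\<close> summands
      and of the new one recombine to exactly \<open>real (Suc n) powr r\<close>.\<close>
    define \<alpha> where "\<alpha> = real n / real (Suc n)"
    define \<beta> where "\<beta> = 1 / real (Suc n)"
    have r: "1 \<le> r" using p by (simp add: r_def)
    have \<alpha>\<beta>: "0 < \<alpha>" "0 < \<beta>" "\<alpha> + \<beta> = 1"
      using False by (auto simp: \<alpha>_def \<beta>_def field_simps)
    define Z where "Z w = p * (Y n w * \<phi> (X w)) + \<alpha> powr (1 - r) * \<bar>X w\<bar> powr p
      + \<beta> powr (1 - r) * (6 * p) powr r * \<bar>Y n w\<bar> powr p" for w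
    have le: "\<bar>\<Sum>j<Suc n. Y j w\<bar> powr p \<le> Z w" for w
    proof -
      have "\<bar>X w + Y n w\<bar> powr p \<le> p * \<phi> (X w) * Y n w + ((X w)\<^sup>2 + 6 * p * (Y n w)\<^sup>2) powr r"
        unfolding \<phi>_def r_def using p by (rule abs_add_powr_le)
      also have "((X w)\<^sup>2 + 6 * p * (Y n w)\<^sup>2) powr r
          \<le> \<alpha> powr (1 - r) * ((X w)\<^sup>2) powr r + \<beta> powr (1 - r) * (6 * p * (Y n w)\<^sup>2) powr r"
        using p r \<alpha>\<beta> by (intro powr_add_le_weighted) auto
      also have "\<dots> = \<alpha> powr (1 - r) * \<bar>X w\<bar> powr p + \<beta> powr (1 - r) * (6 * p) powr r * \<bar>Y n w\<bar> powr p"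
        unfolding powr_mult r_def by (simp add: abs_powr_eq_power2_powr)
      finally show ?thesis by (simp add: X_def Z_def algebra_simps)
    qed
    have int_Z: "integrable M Z"
      unfolding Z_def using cross IH Yn by (intro Bochner_Integration.integrable_add integrable_mult_right)
    have "integrable M (\<lambda>w. \<bar>\<Sum>j<Suc n. Y j w\<bar> powr p)"
      using integrable_add_powr[OF IH(1) Yn(1) X meas] p by (simp add: X_def)
    moreover have "expectation (\<lambda>w. \<bar>\<Sum>j<Suc n. Y j w\<bar> powr p) \<le> (6 * p * Suc n) powr (p / 2) * m"
    proof -
      have "expectation (\<lambda>w. \<bar>\<Sum>j<Suc n. Y j w\<bar> powr p) \<le> expectation Z"
        using calculation int_Z le by (intro integral_mono)
      also have "\<dots> = \<alpha> powr (1 - r) * expectation (\<lambda>w. \<bar>X w\<bar> powr p)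
          + \<beta> powr (1 - r) * (6 * p) powr r * expectation (\<lambda>w. \<bar>Y n w\<bar> powr p)"
        unfolding Z_def using cross IH Yn by simp
      also have "\<dots> \<le> \<alpha> powr (1 - r) * ((6 * p * n) powr r * m) + \<beta> powr (1 - r) * (6 * p) powr r * m"
        using IH(2) Yn(3) unfolding r_def by (intro add_mono mult_left_mono) auto
      also have "\<dots> = (6 * p) powr r * m * (\<alpha> powr (1 - r) * real n powr r + \<beta> powr (1 - r))"
        by (simp add: powr_mult algebra_simps)
      also have "\<alpha> powr (1 - r) * real n powr r + \<beta> powr (1 - r) = real (Suc n) powr r"
      proof -
        have "\<alpha> powr (1 - r) * real n powr r = real n * real (Suc n) powr (r - 1)"
          using False unfolding \<alpha>_def by (simp add: powr_divide powr_diff)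
        moreover have "\<beta> powr (1 - r) = real (Suc n) powr (r - 1)"
          unfolding \<beta>_def by (simp add: powr_divide powr_diff)
        moreover have "real (Suc n) powr r = real (Suc n) * real (Suc n) powr (r - 1)"
          by (simp add: powr_diff del: of_nat_Suc)
        ultimately show ?thesis by (simp add: algebra_simps)
      qed
      finally show ?thesis by (simp add: powr_mult r_def algebra_simps del: of_nat_Suc)
    qed
    ultimately show ?thesis by simp
  qed
qed

lemma mean_indep_moment_bound:
  fixes Y :: "nat \<Rightarrow> 'a \<Rightarrow> real"
  assumes "indep_vars (\<lambda>_. borel) Y {..<n}" and p: "2 \<le> p" and m: "0 \<le> m" and n: "0 < n"
    and "\<And>j. j < n \<Longrightarrow> integrable M (\<lambda>w. \<bar>Y j w\<bar> powr p)"
    and "\<And>j. j < n \<Longrightarrow> expectation (Y j) = 0"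
    and "\<And>j. j < n \<Longrightarrow> expectation (\<lambda>w. \<bar>Y j w\<bar> powr p) \<le> m"
  shows "integrable M (\<lambda>w. \<bar>(\<Sum>j<n. Y j w) / n\<bar> powr p)"
    and "expectation (\<lambda>w. \<bar>(\<Sum>j<n. Y j w) / n\<bar> powr p) \<le> (6 * p / n) powr (p / 2) * m"
proof -
  note sum = sum_indep_moment_bound[OF assms(1-3,5-7)]
  have eq: "\<bar>(\<Sum>j<n. Y j w) / n\<bar> powr p = \<bar>\<Sum>j<n. Y j w\<bar> powr p / real n powr p" for w
    by (simp add: powr_divide)
  show "integrable M (\<lambda>w. \<bar>(\<Sum>j<n. Y j w) / n\<bar> powr p)"
    unfolding eq using sum by simp
  have "expectation (\<lambda>w. \<bar>(\<Sum>j<n. Y j w) / n\<bar> powr p) \<le> (6 * p * n) powr (p / 2) * m / real n powr p"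
    unfolding eq using sum by (simp add: divide_right_mono)
  also have "\<dots> = (6 * p / n) powr (p / 2) * m"
  proof -
    have "real n powr p = real n powr (p / 2) * real n powr (p / 2)"
      by (simp add: powr_add[symmetric])
    then show ?thesis using n by (simp add: powr_mult powr_divide)
  qed
  finally show "expectation (\<lambda>w. \<bar>(\<Sum>j<n. Y j w) / n\<bar> powr p) \<le> (6 * p / n) powr (p / 2) * m" .
qed

text \<open>This is Jensen's inequality for the power \<open>r\<close>, obtained by integrating the
  tangent bound at \<open>U / K\<close>.\<close>

lemma expectation_le_of_powr_expectation_le:
  fixes U :: "'a \<Rightarrow> real"
  assumes U: "integrable M U" "integrable M (\<lambda>w. U w powr r)" "\<And>w. 0 \<le> U w"
    and r: "1 \<le> r" and K: "0 < K" "expectation (\<lambda>w. U w powr r) \<le> K powr r"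
  shows "expectation U \<le> K"
proof -
  have "1 + r * (U w / K - 1) \<le> U w powr r / K powr r" for w
    using Bernoulli_powr[of "U w / K" r] U(3) r K by (simp add: powr_divide)
  then have "expectation (\<lambda>w. 1 + r * (U w / K - 1)) \<le> expectation (\<lambda>w. U w powr r / K powr r)"
    using U by (intro integral_mono) auto
  also have "\<dots> \<le> 1" using K by simp
  finally have "1 + r * (expectation U / K - 1) \<le> 1" using U by (simp add: prob_space)
  then have "expectation U / K \<le> 1" using r by (simp add: mult_le_0_iff)
  then show ?thesis using K by simp
qed

end

section \<open>The regularized true problem\<close>

lemma dot_diff_right: "dot d v (x - y) = dot d v x - dot d v y"
  by (simp add: dot_def algebra_simps sum_subtractf)

lemma dot_scaleR_right: "dot d v (c *\<^sub>R x) = c * dot d v x"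
  by (simp add: dot_def scaleR_fun_def sum_distrib_left algebra_simps)

lemma tendsto_dot: "(u \<longlongrightarrow> x) F \<Longrightarrow> ((\<lambda>n. dot d v (u n)) \<longlongrightarrow> dot d v x) F"
  unfolding dot_def tendsto_rvec_iff by (intro tendsto_sum tendsto_mult tendsto_const) auto

lemma regularizer_nonneg: "0 \<le> regularizer d q x0 x"
  by (simp add: regularizer_def)

lemma continuous_on_regularizer: "0 < q \<Longrightarrow> continuous_on UNIV (regularizer d q x0)"
  unfolding regularizer_def by (intro continuous_intros continuous_on_lq_norm) auto

text \<open>The sublevel bound confines the first \<open>d\<close> coordinates to intervals and the
  others are zero. The set is thus a closed part of a product of compact sets, and Tychonoff's
  theorem applies.\<close>

lemma compact_regularizer_sublevel:
  assumes "0 < q" "closedin (Euclidean_space d) X" "x0 \<in> X"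
  shows "compact {x \<in> X. regularizer d q x0 x \<le> c}"
proof -
  let ?K = "{x \<in> X. regularizer d q x0 x \<le> c}"
  have X: "closed X" "X \<subseteq> Rn d"
    using assms(2) by (auto simp only: closedin_Euclidean_space_iff Rn_def)
  define b where "b = sqrt (2 * c)"
  let ?box = "PiE UNIV (\<lambda>i. if i < d then {x0 i - b..x0 i + b} else {0})"
  have "compactin (powertop_real UNIV) ?box"
    unfolding compactin_PiE compactin_euclidean_iff by (intro disjI2) auto
  then have "compact ?box" by (simp only: euclidean_product_topology compactin_euclidean_iff)
  moreover have "closed ?K"
  proof -
    have "closed {x. regularizer d q x0 x \<le> c}"
      using assms(1) by (intro closed_Collect_le continuous_on_regularizer continuous_on_const)
    then have "closed (X \<inter> {x. regularizer d q x0 x \<le> c})" using X by (intro closed_Int)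
    moreover have "?K = X \<inter> {x. regularizer d q x0 x \<le> c}" by auto
    ultimately show ?thesis by simp
  qed
  moreover have "?K \<subseteq> ?box"
  proof
    fix x assume x: "x \<in> ?K"
    have "x i \<in> (if i < d then {x0 i - b..x0 i + b} else {0})" for i
    proof (cases "i < d")
      case True
      have "(lq_norm d q (x - x0))\<^sup>2 \<le> 2 * c" using x by (simp add: regularizer_def)
      then have "lq_norm d q (x - x0) \<le> b"
        unfolding b_def by (intro real_le_rsqrt)
      then have "\<bar>x i - x0 i\<bar> \<le> b"
        using abs_le_lq_norm[OF assms(1) True, of "x - x0"] by simp
      then show ?thesis using True by (auto simp: abs_le_iff)
    next
      case False
      then show ?thesis using x X by (auto simp: Rn_iff)
    qed
    then show "x \<in> ?box" by auto
  qed
  ultimately show ?thesis using compact_Int_closed[of ?box ?K] by (simp only: Int_absorb1)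
qed

section \<open>Integrals of functions that agree almost surely with a Borel function\<close>

lemma (in complete_measure) borel_measurable_AE_cong:
  fixes g h :: "'a \<Rightarrow> real"
  assumes g: "g \<in> borel_measurable M" and eq: "AE w in M. h w = g w"
  shows "h \<in> borel_measurable M"
proof (rule measurableI)
  fix A :: "real set" assume A: "A \<in> sets borel"
  show "h -` A \<inter> space M \<in> sets M"
  proof (rule in_sets_AE)
    show "AE w in M. w \<in> g -` A \<inter> space M \<longleftrightarrow> w \<in> h -` A \<inter> space M"
      using eq by eventually_elim auto
    show "g -` A \<inter> space M \<in> sets M" using g A by (rule measurable_sets)
  qed simp
qed simp

text \<open>The function \<open>h\<close> may fail to be measurable on \<open>N\<close>;
  completeness of \<open>M\<close> still makes its composition with \<open>Y\<close> measurable, and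
  its integral passes to the law through the version \<open>g\<close>. This is what coordinates of
  \<open>G\<close> require.\<close>

lemma (in complete_measure) integral_law_AE_cong:
  fixes g h :: "'b \<Rightarrow> real"
  assumes Y: "Y \<in> M \<rightarrow>\<^sub>M N" and g: "g \<in> borel_measurable N"
    and eq: "AE u in distr M N Y. h u = g u"
  shows "(\<lambda>w. h (Y w)) \<in> borel_measurable M"
    and "integrable M (\<lambda>w. h (Y w)) \<longleftrightarrow> integrable (distr M N Y) g"
    and "(\<integral>w. h (Y w) \<partial>M) = (\<integral>u. g u \<partial>distr M N Y)"
proof -
  have eq': "AE w in M. h (Y w) = g (Y w)" using AE_distrD[OF Y eq] .
  have gY: "(\<lambda>w. g (Y w)) \<in> borel_measurable M" using measurable_compose[OF Y g] .
  then show hY: "(\<lambda>w. h (Y w)) \<in> borel_measurable M" using eq' by (rule borel_measurable_AE_cong)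
  show "integrable M (\<lambda>w. h (Y w)) \<longleftrightarrow> integrable (distr M N Y) g"
    unfolding integrable_distr_eq[OF Y g] using hY gY eq' by (rule integrable_cong_AE)
  show "(\<integral>w. h (Y w) \<partial>M) = (\<integral>u. g u \<partial>distr M N Y)"
    unfolding integral_distr[OF Y g] using hY gY eq' by (rule integral_cong_AE)
qed

context stochastic_program
begin

abbreviation "RXi \<equiv> restrict_space borel Xi"
abbreviation "law \<equiv> distr M RXi xi"
abbreviation "F \<equiv> expected_cost M xi f"

lemma f_measurable: "x \<in> B \<Longrightarrow> f x \<in> borel_measurable RXi"
  using measurable_Pair_compose_split[OF f, of "\<lambda>_. x" RXi "\<lambda>u. u"]
  by (simp add: space_restrict_space)

lemma xi_subgradient: "x \<in> X \<Longrightarrow> AE w in M. G x (xi w) \<in> subdifferential d B (\<lambda>y. f y (xi w)) x"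
  using AE_distrD[OF xi G_subgradient] .

text \<open>Push the law of \<open>xi\<close> onto the slice over \<open>z\<close> and call it
  \<open>\<mu>\<close>. Universal measurability makes \<open>G\<close> measurable for the completion
  of \<open>\<mu>\<close>, so each of the countably many coordinates has a Borel version.\<close>

lemma G_borel_version:
  assumes z: "z \<in> X"
  shows "\<exists>g. (\<forall>i. g i \<in> borel_measurable RXi) \<and> (AE u in law. \<forall>i. G z u i = g i u)"
proof -
  let ?P = "restrict_space borel X \<Otimes>\<^sub>M RXi"
  have pair: "(\<lambda>u. (z, u)) \<in> law \<rightarrow>\<^sub>M ?P"
    using z by (intro measurable_Pair) (auto simp: space_restrict_space)
  define \<mu> where "\<mu> = distr law ?P (\<lambda>u. (z, u))"
  interpret law: prob_space law using xi by (rule prob_space_distr)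
  interpret \<mu>: prob_space \<mu> unfolding \<mu>_def using pair by (rule law.prob_space_distr)
  have "case_prod G \<in> completion \<mu> \<rightarrow>\<^sub>M restrict_space borel (Rn d)"
    using G_measurable \<mu>.finite_measure_axioms
    unfolding universally_measurable_def by (auto simp: \<mu>_def)
  then have G: "case_prod G \<in> completion \<mu> \<rightarrow>\<^sub>M borel"
    by (rule measurable_restrict_space2_iff[THEN iffD1, THEN conjunct1])
  have "\<exists>g\<in>borel_measurable \<mu>. AE x in \<mu>. case_prod G x i = g x" for i
  proof (rule completion_ex_borel_measurable_real)
    have "(\<lambda>y. y i) \<in> borel_measurable (borel :: rvec measure)"
      by (intro borel_measurable_continuous_onI) simp
    from measurable_compose[OF G this]
    show "(\<lambda>x. case_prod G x i) \<in> borel_measurable (completion \<mu>)" .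
  qed
  then obtain g where g: "\<And>i. g i \<in> borel_measurable \<mu>" "\<And>i. AE x in \<mu>. case_prod G x i = g i x"
    by metis
  have "(\<lambda>u. g i (z, u)) \<in> borel_measurable RXi" for i
  proof -
    have "g i \<in> borel_measurable ?P" using g(1)[of i] by (simp add: \<mu>_def)
    from measurable_compose[OF pair this] show ?thesis by simp
  qed
  moreover have "AE u in law. \<forall>i. G z u i = g i (z, u)"
    unfolding AE_all_countable using AE_distrD[OF pair g(2)[unfolded \<mu>_def]] by simp
  ultimately show ?thesis by (intro exI[of _ "\<lambda>i u. g i (z, u)"] conjI allI)
qed

text \<open>Fatou's lemma, with the affine minorant that the subgradient at \<open>xstar\<close> provides.\<close>

lemma expected_cost_lsc:
  assumes G_int: "\<And>i. i < d \<Longrightarrow> integrable M (\<lambda>w. G xstar (xi w) i)"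
    and u: "\<And>n. u n \<in> X" "u \<longlonglongrightarrow> x" and x: "x \<in> X"
    and c: "\<And>n. F (u n) \<le> c n" "c \<longlonglongrightarrow> c0"
  shows "F x \<le> c0"
proof -
  \<comment> \<open>By the subgradient inequality at \<open>xstar\<close> this is almost surely
    nonnegative on \<open>X\<close>, and its mean differs from \<open>F\<close> by an affine
    function. Fatou's lemma for \<open>H\<close> therefore speaks about \<open>F\<close>.\<close>
  define H where "H y w = f y (xi w) - f xstar (xi w) - dot d (G xstar (xi w)) (y - xstar)" for y w
  define \<mu> where "\<mu> = mean_vec M (\<lambda>w. G xstar (xi w))"
  have dot_int: "integrable M (\<lambda>w. dot d (G xstar (xi w)) v)" for v
    unfolding dot_def using G_int by (intro Bochner_Integration.integrable_sum integrable_mult_left) auto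
  have dot_mean: "(\<integral>w. dot d (G xstar (xi w)) v \<partial>M) = dot d \<mu> v" for v
    unfolding dot_def \<mu>_def mean_vec_def using G_int
    by (subst Bochner_Integration.integral_sum) (auto intro!: integrable_mult_left)
  have H_int: "integrable M (H y)" and H_mean: "(\<integral>w. H y w \<partial>M) = F y - F xstar - dot d \<mu> (y - xstar)"
    if "y \<in> X" for y
    unfolding H_def using F_finite[OF that] F_finite[OF xstar(1)] dot_int
    by (auto simp: dot_mean expected_cost_def)
  have H_nonneg: "AE w in M. 0 \<le> H y w" if "y \<in> X" for y
    using xi_subgradient[OF xstar(1)]
  proof eventually_elim
    case (elim w)
    then show ?case using that X(2) unfolding subdifferential_def H_def by (auto simp: algebra_simps)
  qed
  have nn: "(\<integral>\<^sup>+ w. ennreal (H y w) \<partial>M) = ennreal (F y - F xstar - dot d \<mu> (y - xstar))" if "y \<in> X" for y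
    using nn_integral_eq_integral[OF H_int[OF that] H_nonneg[OF that]] H_mean[OF that] by simp
  have "AE w in M. ennreal (H x w) \<le> liminf (\<lambda>n. ennreal (H (u n) w))"
    using xi_subgradient[OF x]
  proof eventually_elim
    case (elim w)
    \<comment> \<open>The subgradient at the limit \<open>x\<close> gives this lower bound for
      \<open>H (u n) w\<close>, and it tends to \<open>H x w\<close>; this is lower semicontinuity
      outcome by outcome.\<close>
    define L where "L n = H x w + dot d (G x (xi w)) (u n - x) - dot d (G xstar (xi w)) (u n - x)" for n
    have "L n \<le> H (u n) w" for n
    proof -
      have "f x (xi w) + dot d (G x (xi w)) (u n - x) \<le> f (u n) (xi w)"
        using elim u(1)[of n] X(2) unfolding subdifferential_def by auto
      then show ?thesis unfolding L_def H_def by (simp add: dot_diff_right)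
    qed
    then have "liminf (\<lambda>n. ennreal (L n)) \<le> liminf (\<lambda>n. ennreal (H (u n) w))"
      by (intro Liminf_mono always_eventually allI ennreal_leI)
    moreover have "(\<lambda>n. ennreal (L n)) \<longlonglongrightarrow> ennreal (H x w)"
    proof (rule tendsto_ennrealI)
      have "(\<lambda>n. dot d v (u n - x)) \<longlonglongrightarrow> 0" for v
        using tendsto_dot[OF u(2), of d v] unfolding dot_diff_right by (rule LIM_zero)
      from tendsto_diff[OF tendsto_add[OF tendsto_const[of "H x w"] this] this]
      show "L \<longlonglongrightarrow> H x w" unfolding L_def by simp
    qed
    then have "liminf (\<lambda>n. ennreal (L n)) = ennreal (H x w)"
      by (rule lim_imp_Liminf[OF sequentially_bot])
    ultimately show ?case by simp
  qed
  then have "(\<integral>\<^sup>+ w. ennreal (H x w) \<partial>M) \<le> (\<integral>\<^sup>+ w. liminf (\<lambda>n. ennreal (H (u n) w)) \<partial>M)"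
    by (rule nn_integral_mono_AE)
  also have "\<dots> \<le> liminf (\<lambda>n. \<integral>\<^sup>+ w. ennreal (H (u n) w) \<partial>M)"
    using H_int u(1) by (intro nn_integral_liminf) (auto dest: borel_measurable_integrable)
  also have "\<dots> \<le> liminf (\<lambda>n. ennreal (c n - F xstar - dot d \<mu> (u n - xstar)))"
    unfolding nn[OF u(1)] using c(1)
    by (intro Liminf_mono always_eventually allI ennreal_leI diff_right_mono)
  also have "\<dots> = ennreal (c0 - F xstar - dot d \<mu> (x - xstar))"
  proof (rule lim_imp_Liminf[OF sequentially_bot], rule tendsto_ennrealI)
    show "(\<lambda>n. c n - F xstar - dot d \<mu> (u n - xstar)) \<longlonglongrightarrow> c0 - F xstar - dot d \<mu> (x - xstar)"
      unfolding dot_diff_right using c(2) by (intro tendsto_intros tendsto_dot u(2))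
  qed
  finally have "ennreal (F x - F xstar - dot d \<mu> (x - xstar)) \<le> ennreal (c0 - F xstar - dot d \<mu> (x - xstar))"
    unfolding nn[OF x] .
  \<comment> \<open>\<open>ennreal\<close> sends negative reals to 0, so the comparison yields a
    real inequality only once its right side is known to be nonnegative.\<close>
  moreover have "0 \<le> c0 - F xstar - dot d \<mu> (x - xstar)"
  proof (rule LIMSEQ_le_const)
    show "(\<lambda>n. c n - F xstar - dot d \<mu> (u n - xstar)) \<longlonglongrightarrow> c0 - F xstar - dot d \<mu> (x - xstar)"
      unfolding dot_diff_right using c(2) by (intro tendsto_intros tendsto_dot u(2))
    have "0 \<le> F (u n) - F xstar - dot d \<mu> (u n - xstar)" for n
      using H_mean[OF u(1)[of n]] H_nonneg[OF u(1)[of n]] integral_nonneg_AE by metis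
    then show "\<exists>n0. \<forall>n\<ge>n0. 0 \<le> c n - F xstar - dot d \<mu> (u n - xstar)"
      using c(1) by (intro exI[of _ 0]) (smt (verit))
  qed
  ultimately show ?thesis by (simp add: ennreal_le_iff)
qed

text \<open>Outside \<open>?K\<close> the regularizer exceeds its value at \<open>xstar\<close>
  while \<open>F\<close> is not below \<open>F xstar\<close>, so such points cannot beat
  \<open>xstar\<close>. On the compact set \<open>?K\<close> a minimizing sequence has a convergent
  subsequence, and lower semicontinuity passes to its limit.\<close>

lemma regularized_minimizer_exists:
  assumes G_int: "\<And>i. i < d \<Longrightarrow> integrable M (\<lambda>w. G xstar (xi w) i)"
    and q: "0 < q" and lam: "0 < lam" and x0: "x0 \<in> X"
  obtains e where "e \<in> X"
    "\<And>x. x \<in> X \<Longrightarrow> F e + lam * regularizer d q x0 e \<le> F x + lam * regularizer d q x0 x"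
proof -
  let ?V = "regularizer d q x0"
  let ?K = "{x \<in> X. ?V x \<le> ?V xstar}"
  define \<Phi> where "\<Phi> x = F x + lam * ?V x" for x
  define I where "I = Inf (\<Phi> ` ?K)"
  have low: "F xstar \<le> \<Phi> x" if "x \<in> X" for x
    using xstar(2)[OF that] lam regularizer_nonneg[of d q x0 x] by (simp add: \<Phi>_def add_increasing2)
  have bdd: "bdd_below (\<Phi> ` ?K)" by (intro bdd_belowI[of _ "F xstar"]) (auto intro: low)
  have ne: "\<Phi> ` ?K \<noteq> {}" using xstar(1) by auto
  have "\<exists>x\<in>?K. \<Phi> x < I + 1 / real (Suc n)" for n
    using cInf_less_iff[OF ne bdd, of "I + 1 / real (Suc n)"] unfolding I_def by auto
  then obtain u where u: "\<And>n. u n \<in> ?K" "\<And>n. \<Phi> (u n) < I + 1 / real (Suc n)"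
    by metis
  have "compact ?K" using q X(3) x0 by (rule compact_regularizer_sublevel)
  then have "seq_compact ?K" by (rule compact_imp_seq_compact)
  then obtain e r where e: "e \<in> ?K" "strict_mono r" "(u \<circ> r) \<longlonglongrightarrow> e"
    using u(1) unfolding seq_compact_def by blast
  have V: "(\<lambda>n. ?V (u (r n))) \<longlonglongrightarrow> ?V e"
    using continuous_on_tendsto_compose[OF continuous_on_regularizer[OF q] e(3)] by (simp add: comp_def)
  \<comment> \<open>The regularizer is continuous, so it is moved into the upper bounds and only
    \<open>F\<close> needs lower semicontinuity.\<close>
  have "F e \<le> I + 0 - lam * ?V e"
  proof (rule expected_cost_lsc[OF G_int])
    show "(u \<circ> r) n \<in> X" for n using u(1) by simp
    show "F ((u \<circ> r) n) \<le> I + 1 / real (Suc (r n)) - lam * ?V (u (r n))" for n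
      using u(2)[of "r n"] by (simp add: \<Phi>_def)
    have "(\<lambda>n. 1 / real (Suc (r n))) \<longlonglongrightarrow> 0"
      using LIMSEQ_subseq_LIMSEQ[OF LIMSEQ_inverse_real_of_nat e(2)]
      by (simp add: comp_def inverse_eq_divide)
    then show "(\<lambda>n. I + 1 / real (Suc (r n)) - lam * ?V (u (r n))) \<longlonglongrightarrow> I + 0 - lam * ?V e"
      by (intro tendsto_intros V)
    show "(u \<circ> r) \<longlonglongrightarrow> e" by (rule e(3))
    show "e \<in> X" using e(1) by simp
  qed
  then have eI: "\<Phi> e \<le> I" by (simp add: \<Phi>_def)
  have "\<Phi> e \<le> \<Phi> x" if x: "x \<in> X" for x
  proof (cases "x \<in> ?K")
    case True
    then have "I \<le> \<Phi> x" unfolding I_def by (intro cInf_lower bdd) auto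
    then show ?thesis using eI by simp
  next
    case False
    have "I \<le> \<Phi> xstar" unfolding I_def using xstar(1) by (intro cInf_lower bdd) auto
    also have "\<dots> \<le> \<Phi> x"
      unfolding \<Phi>_def using False x xstar(2)[OF x] lam by (intro add_mono mult_left_mono) auto
    finally show ?thesis using eI by simp
  qed
  then show thesis using that[of e] e(1) by (simp add: \<Phi>_def)
qed

text \<open>Take a short step from \<open>e\<close> towards \<open>h\<close>: minimality bounds the
  change of the objective from below, differentiability of \<open>F\<close> and strong convexity of
  the regularizer bound it from above. Dividing by the step length and letting it vanish leaves the
  quadratic gain.\<close>

lemma regularized_minimizer_first_order:
  assumes e: "e \<in> X"
    and min: "\<And>x. x \<in> X \<Longrightarrow> F e + lam * regularizer d s x0 e \<le> F x + lam * regularizer d s x0 x"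
    and grad: "has_gradient d F v e" and s: "1 < s" "s \<le> 2" and lam: "0 < lam" and h: "h \<in> X"
  shows "lam * ((s - 1) / 2) * (lq_norm d s (h - e))\<^sup>2
    \<le> dot d v (h - e) + lam * (regularizer d s x0 h - regularizer d s x0 e)"
proof -
  let ?V = "regularizer d s x0" and ?D = "(lq_norm d s (h - e))\<^sup>2" and ?n2 = "lq_norm d 2 (h - e)"
  define A where "A = dot d v (h - e) + lam * (?V h - ?V e)"
  define t :: "nat \<Rightarrow> real" where "t k = 1 / 2 ^ k" for k
  define x where "x k = e + t k *\<^sub>R (h - e)" for k
  have t: "0 < t k" "t k \<le> 1" for k unfolding t_def by simp_all
  have t0: "t \<longlonglongrightarrow> 0" unfolding t_def using LIMSEQ_divide_realpow_zero[of 2 1] by simp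
  have XRn: "X \<subseteq> Rn d" using X(3) by (simp only: closedin_Euclidean_space_iff Rn_def)
  have x: "x k \<in> X" for k
  proof -
    have "(1 - t k) *\<^sub>R e + t k *\<^sub>R h \<in> X" using t[of k] by (intro convexD_alt[OF X(4) e h]) auto
    moreover have "x k = (1 - t k) *\<^sub>R e + t k *\<^sub>R h"
      by (simp add: x_def fun_eq_iff scaleR_fun_def left_diff_distrib right_diff_distrib)
    ultimately show ?thesis by simp
  qed
  have le: "lam * ((s - 1) / 2) * ?D \<le> A + \<eta> * ?n2" if \<eta>: "0 < \<eta>" for \<eta>
  proof -
    obtain r where r: "0 < r" "\<And>y. y \<in> Rn d \<Longrightarrow> lq_norm d 2 (y - e) < r \<Longrightarrow>
        \<bar>F y - F e - dot d v (y - e)\<bar> \<le> \<eta> * lq_norm d 2 (y - e)"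
      using grad \<eta> unfolding has_gradient_def by blast
    have xe: "lq_norm d 2 (x k - e) = t k * ?n2" for k
      using t[of k] unfolding x_def by (simp add: lq_norm_scaleR)
    have "(\<lambda>k. t k * ?n2) \<longlonglongrightarrow> 0" using tendsto_mult_right[OF t0, of ?n2] by simp
    then have "\<forall>\<^sub>F k in sequentially. t k * ?n2 < r" using r(1) by (rule order_tendstoD)
    then have ev: "\<forall>\<^sub>F k in sequentially. lam * ((s - 1) / 2) * (1 - t k) * ?D \<le> A + \<eta> * ?n2"
    proof eventually_elim
      case (elim k)
      have "F (x k) - F e \<le> t k * dot d v (h - e) + \<eta> * (t k * ?n2)"
        using r(2)[of "x k"] x[of k] XRn elim xe[of k]
        by (auto simp: x_def dot_scaleR_right abs_le_iff)
      moreover have "F e - F (x k) \<le> lam * (?V (x k) - ?V e)"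
        using min[OF x[of k]] by (simp add: algebra_simps)
      moreover have "lam * (?V (x k) - ?V e) \<le> lam * (t k * (?V h - ?V e) - (s - 1) / 2 * t k * (1 - t k) * ?D)"
        using regularizer_strongly_convex_dyadic[OF s, of d x0 e k h] lam
        by (intro mult_left_mono) (auto simp: x_def t_def algebra_simps)
      ultimately have "t k * (lam * ((s - 1) / 2) * (1 - t k) * ?D) \<le> t k * (A + \<eta> * ?n2)"
        by (simp add: A_def algebra_simps)
      then show ?case using t(1)[of k] by (simp only: mult_le_cancel_left_pos)
    qed
    have "(\<lambda>k. lam * ((s - 1) / 2) * (1 - t k) * ?D) \<longlonglongrightarrow> lam * ((s - 1) / 2) * (1 - 0) * ?D"
      by (intro tendsto_intros t0)
    from tendsto_upperbound[OF this ev] show ?thesis by simp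
  qed
  have "lam * ((s - 1) / 2) * ?D \<le> A"
  proof (rule field_le_epsilon)
    fix \<eta> :: real assume \<eta>: "0 < \<eta>"
    have n2: "0 \<le> ?n2" by (rule lq_norm_nonneg)
    \<comment> \<open>Adding 1 keeps the divisor positive when \<open>h\<close> and \<open>e\<close>
      are at distance zero.\<close>
    have "\<eta> / (?n2 + 1) * ?n2 \<le> \<eta>" using \<eta> n2 by (simp add: field_simps)
    then show "lam * ((s - 1) / 2) * ?D \<le> A + \<eta>"
      using le[of "\<eta> / (?n2 + 1)"] \<eta> n2 by (smt (verit) divide_pos_pos)
  qed
  then show ?thesis unfolding A_def .
qed

end

section \<open>The error of the approximate solution\<close>

context regularized_saa
begin

abbreviation "Xopt \<equiv> eps_optimal X F xstar \<epsilon>"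
abbreviation "xhat \<equiv> saa_estimator N sample xt"
abbreviation "lam \<equiv> \<epsilon> / (2 * R)"

section \<open>The sample, its joint law and the estimator\<close>

lemma R_ge_1: "1 \<le> R" and lam_pos: "0 < lam"
  using R eps by auto

lemma xstar_Xopt: "xstar \<in> Xopt"
  using xstar(1) eps by (simp add: eps_optimal_def)

lemma Xopt_subset: "Xopt \<subseteq> X"
  by (auto simp: eps_optimal_def)

lemma sample_measurable: "j < N \<Longrightarrow> sample j \<in> M \<rightarrow>\<^sub>M RXi"
  using sample_indep unfolding indep_vars_def by auto

lemma sample_tuple_measurable:
  "(\<lambda>w. \<lambda>j\<in>{..<N}. sample j w) \<in> M \<rightarrow>\<^sub>M (\<Pi>\<^sub>M j\<in>{..<N}. RXi)"
  using sample_measurable by (intro measurable_restrict) auto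

lemma sample_tuple_law:
  "distr M (\<Pi>\<^sub>M j\<in>{..<N}. RXi) (\<lambda>w. \<lambda>j\<in>{..<N}. sample j w) = (\<Pi>\<^sub>M j\<in>{..<N}. law)"
proof -
  have "distr M (\<Pi>\<^sub>M j\<in>{..<N}. RXi) (\<lambda>w. \<lambda>j\<in>{..<N}. sample j w)
      = (\<Pi>\<^sub>M j\<in>{..<N}. distr M RXi (sample j))"
    using N sample_indep sample_measurable
    by (subst indep_vars_iff_distr_eq_PiM'[symmetric]) (auto simp: lessThan_empty_iff)
  also have "\<dots> = (\<Pi>\<^sub>M j\<in>{..<N}. law)" using sample_law by (intro PiM_cong) auto
  finally show ?thesis .
qed

lemma xhat_measurable: "xhat \<in> M \<rightarrow>\<^sub>M restrict_space borel X"
  using measurable_compose[OF sample_tuple_measurable xt_measurable]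
  by (simp add: saa_estimator_def[abs_def])

lemma xhat_in_X: "w \<in> space M \<Longrightarrow> xhat w \<in> X"
  using measurable_space[OF xhat_measurable] by (simp add: space_restrict_space)

lemma xhat_error_measurable: "(\<lambda>w. (lq_norm d q (c - xhat w))\<^sup>2) \<in> borel_measurable M"
proof -
  have "0 < q" using q q' by simp
  have "xhat \<in> borel_measurable M"
    using xhat_measurable by (simp add: measurable_restrict_space2_iff)
  from measurable_compose[OF this borel_measurable_lq_norm[OF \<open>0 < q\<close>, of d c]]
  have "(\<lambda>w. lq_norm d q (c - xhat w)) \<in> borel_measurable M"
    by (subst lq_norm_minus_commute)
  then show ?thesis by (rule borel_measurable_power)
qed

lemma AE_xhat_approx:
  "AE w in M. \<exists>g \<in> subdifferential d B (saa_objective d f N lam q' x0 (\<lambda>j\<in>{..<N}. sample j w)) (xhat w).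
     \<forall>x\<in>X. - \<delta> * lq_norm d q (x - xhat w) \<le> dot d g (x - xhat w)"
  using AE_distrD[OF sample_tuple_measurable xt_approx[folded sample_tuple_law]]
  by (simp add: saa_estimator_def)

lemma AE_sample:
  assumes "AE u in law. P u"
  shows "AE w in M. \<forall>j<N. P (sample j w)"
proof -
  have "AE w in M. P (sample j w)" if "j < N" for j
    using AE_distrD[OF sample_measurable[OF that] assms[folded sample_law[OF that]]] .
  then have "AE w in M. \<forall>j\<in>{..<N}. P (sample j w)" by (intro AE_finite_allI) auto
  then show ?thesis by eventually_elim simp
qed

text \<open>Two subgradient inequalities are tested against each other: that of the regularized
  objective at \<open>h\<close> towards \<open>e\<close>, and those of the summands at
  \<open>e\<close> towards \<open>h\<close>. The sampled gradients are thus taken only at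
  \<open>e\<close>, which will be deterministic.\<close>

lemma saa_minimizer_comparison:
  assumes e: "e \<in> X" and h: "h \<in> X"
    and gg: "gg \<in> subdifferential d B (saa_objective d f N lam q' x0 s) h"
      "\<forall>x\<in>X. - \<delta> * lq_norm d q (x - h) \<le> dot d gg (x - h)"
    and G: "\<And>j. j < N \<Longrightarrow> G e (s j) \<in> subdifferential d B (\<lambda>y. f y (s j)) e"
  shows "lam * (regularizer d q' x0 h - regularizer d q' x0 e) + (\<Sum>j<N. dot d (G e (s j)) (h - e)) / N
    \<le> \<delta> * lq_norm d q (h - e)"
proof -
  let ?V = "regularizer d q' x0"
  have "saa_objective d f N lam q' x0 s h + dot d gg (e - h) \<le> saa_objective d f N lam q' x0 s e"
    using gg(1) e X(2) unfolding subdifferential_def by auto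
  moreover have "- \<delta> * lq_norm d q (h - e) \<le> dot d gg (e - h)"
    using gg(2) e lq_norm_minus_commute[of d q e h] by auto
  ultimately have 1: "(\<Sum>j<N. f h (s j)) / N + lam * ?V h - \<delta> * lq_norm d q (h - e)
      \<le> (\<Sum>j<N. f e (s j)) / N + lam * ?V e"
    unfolding saa_objective_def by linarith
  have "(\<Sum>j<N. f e (s j) + dot d (G e (s j)) (h - e)) \<le> (\<Sum>j<N. f h (s j))"
    using G h X(2) unfolding subdifferential_def by (intro sum_mono) auto
  then have "(\<Sum>j<N. f e (s j)) / N + (\<Sum>j<N. dot d (G e (s j)) (h - e)) / N \<le> (\<Sum>j<N. f h (s j)) / N"
    by (simp add: sum.distrib divide_right_mono flip: add_divide_distrib)
  then show ?thesis using 1 by (simp add: right_diff_distrib)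
qed

text \<open>The first-order terms of \<open>F\<close> and of its sample average combine into the sampling error of the gradient.\<close>

lemma error_le_gradient_noise:
  assumes first_order: "lam * ((q' - 1) / 2) * (lq_norm d q' (h - e))\<^sup>2
      \<le> dot d \<mu> (h - e) + lam * (regularizer d q' x0 h - regularizer d q' x0 e)"
    and saa: "lam * (regularizer d q' x0 h - regularizer d q' x0 e) + (\<Sum>j<N. dot d (\<gamma> j) (h - e)) / N
      \<le> \<delta> * lq_norm d q (h - e)"
  shows "(lq_norm d q (e - h))\<^sup>2 \<le> 32 * R\<^sup>2 / ((q' - 1)\<^sup>2 * \<epsilon>\<^sup>2)
    * (\<delta>\<^sup>2 + (lq_norm d p (\<lambda>i. (\<Sum>j<N. \<gamma> j i - \<mu> i) / N))\<^sup>2)"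
proof -
  let ?D = "lq_norm d q' (h - e)" and ?\<Delta> = "\<lambda>i. (\<Sum>j<N. \<gamma> j i - \<mu> i) / N"
  let ?T = "lq_norm d p ?\<Delta>" and ?k = "lam * ((q' - 1) / 2)"
  have N0: "0 < real N" using N by simp
  have D: "0 \<le> ?D" and T: "0 \<le> ?T" by (rule lq_norm_nonneg)+
  have k: "0 < ?k" using lam_pos q' by (intro mult_pos_pos) auto
  have Dq: "lq_norm d q (h - e) \<le> ?D" using q q' by (intro lq_norm_antimono) auto
  have "(\<Sum>j<N. dot d (\<gamma> j) (h - e)) / N - dot d \<mu> (h - e) = dot d ?\<Delta> (h - e)"
  proof -
    have "dot d ?\<Delta> (h - e) = (\<Sum>i<d. (\<Sum>j<N. \<gamma> j i * (h - e) i) / N - \<mu> i * (h - e) i)"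
      unfolding dot_def
    proof (rule sum.cong[OF refl])
      fix i
      have "?\<Delta> i = (\<Sum>j<N. \<gamma> j i) / N - \<mu> i"
        using N0 by (simp add: sum_subtractf diff_divide_distrib)
      then show "?\<Delta> i * (h - e) i = (\<Sum>j<N. \<gamma> j i * (h - e) i) / N - \<mu> i * (h - e) i"
        by (simp add: left_diff_distrib sum_distrib_right)
    qed
    also have "\<dots> = (\<Sum>i<d. \<Sum>j<N. \<gamma> j i * (h - e) i) / N - dot d \<mu> (h - e)"
      by (simp add: sum_subtractf sum_divide_distrib dot_def)
    also have "(\<Sum>i<d. \<Sum>j<N. \<gamma> j i * (h - e) i) = (\<Sum>j<N. dot d (\<gamma> j) (h - e))"
      unfolding dot_def by (rule sum.swap)
    finally show ?thesis by (simp add: fun_diff_def)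
  qed
  then have "?k * ?D\<^sup>2 \<le> \<delta> * lq_norm d q (h - e) - dot d ?\<Delta> (h - e)"
    using first_order saa by linarith
  also have "- dot d ?\<Delta> (h - e) = dot d ?\<Delta> (e - h)" by (simp add: dot_diff_right)
  then have "\<delta> * lq_norm d q (h - e) - dot d ?\<Delta> (h - e) \<le> \<delta> * ?D + ?T * ?D"
  proof -
    \<comment> \<open>This is the dual exponent of \<open>p\<close>. The assumption
      \<open>p \<le> q' / (q' - 1)\<close> says exactly that \<open>q'\<close> does not exceed it,
      so Hoelder's second factor is at most the \<open>q'\<close>-norm.\<close>
    let ?p' = "p / (p - 1)"
    have p': "1 < ?p'" "1 / p + 1 / ?p' = 1" using p by (auto simp: field_simps)
    have "p * (q' - 1) \<le> q'" using p(2) q' by (simp add: pos_le_divide_eq)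
    then have "q' * (p - 1) \<le> p" by (simp add: algebra_simps)
    then have q'p': "q' \<le> ?p'" using p by (simp add: pos_le_divide_eq)
    have "dot d ?\<Delta> (e - h) \<le> ?T * lq_norm d ?p' (e - h)"
      using p p' by (intro dot_Hoelder) auto
    also have "\<dots> \<le> ?T * lq_norm d q' (e - h)"
      using T q' q'p' by (intro mult_left_mono lq_norm_antimono) auto
    finally have "dot d ?\<Delta> (e - h) \<le> ?T * ?D" by (simp add: lq_norm_minus_commute)
    moreover have "\<delta> * lq_norm d q (h - e) \<le> \<delta> * ?D" using Dq delta by (intro mult_left_mono) auto
    ultimately show ?thesis by (simp add: dot_diff_right)
  qed
  finally have "?D * (?k * ?D) \<le> ?D * (\<delta> + ?T)" by (simp add: power2_eq_square algebra_simps)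
  then have "?k * ?D \<le> \<delta> + ?T"
  proof (cases "?D = 0")
    case True
    then show ?thesis using T delta by simp
  next
    case False
    then have "0 < ?D" using D by linarith
    then show ?thesis using \<open>?D * (?k * ?D) \<le> ?D * (\<delta> + ?T)\<close> by (simp only: mult_le_cancel_left_pos)
  qed
  then have kD: "(?k * ?D)\<^sup>2 \<le> (\<delta> + ?T)\<^sup>2"
    using mult_nonneg_nonneg[OF less_imp_le[OF k] D] by (rule power_mono)
  have "(\<delta> + ?T)\<^sup>2 \<le> 2 * (\<delta>\<^sup>2 + ?T\<^sup>2)"
    using sum_squares_ge_zero[of "\<delta> - ?T" 0] by (simp add: power2_eq_square algebra_simps)
  with kD have "(?k * ?D)\<^sup>2 \<le> 2 * (\<delta>\<^sup>2 + ?T\<^sup>2)" by (rule order_trans)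
  then have "?k\<^sup>2 * ?D\<^sup>2 \<le> 2 * (\<delta>\<^sup>2 + ?T\<^sup>2)" by (simp only: power_mult_distrib)
  then have "?D\<^sup>2 \<le> 2 * (\<delta>\<^sup>2 + ?T\<^sup>2) / ?k\<^sup>2"
    unfolding pos_le_divide_eq[OF zero_less_power[OF k]] by (simp only: mult.commute)
  \<comment> \<open>Since \<open>?k = (q' - 1) * \<epsilon> / (4 * R)\<close>, the 32 is 2 from
    squaring the sum times 16 from the square of 4.\<close>
  also have "\<dots> = 32 * R\<^sup>2 / ((q' - 1)\<^sup>2 * \<epsilon>\<^sup>2) * (\<delta>\<^sup>2 + ?T\<^sup>2)"
  proof -
    have *: "2 * y / (c / (4 * R))\<^sup>2 = 32 * R\<^sup>2 / c\<^sup>2 * y" for y c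
      by (simp add: power_divide power_mult_distrib)
    have "?k = (q' - 1) * \<epsilon> / (4 * R)" by simp
    then show ?thesis by (simp only: * power_mult_distrib)
  qed
  finally have "?D\<^sup>2 \<le> 32 * R\<^sup>2 / ((q' - 1)\<^sup>2 * \<epsilon>\<^sup>2) * (\<delta>\<^sup>2 + ?T\<^sup>2)" .
  moreover have "(lq_norm d q (e - h))\<^sup>2 \<le> ?D\<^sup>2"
    using Dq lq_norm_nonneg by (subst lq_norm_minus_commute) (intro power_mono)
  ultimately show ?thesis by linarith
qed

text \<open>The scalar moment bound is applied to each coordinate with the same factor, and the
  coordinate moments sum to at most \<open>\<psi> powr p\<close>, so no power of the dimension
  enters. The Borel version \<open>g\<close> lets independence and laws pass through composition
  with the sample.\<close>

lemma gradient_noise_moment: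
  assumes e: "e \<in> Xopt" and g: "\<And>i. g i \<in> borel_measurable RXi"
    and G: "AE u in law. \<forall>i. G e u i = g i u"
  defines "\<mu> \<equiv> mean_vec M (\<lambda>w. G e (xi w))"
  defines "S \<equiv> \<lambda>w. \<Sum>i<d. \<bar>(\<Sum>j<N. g i (sample j w) - \<mu> i) / N\<bar> powr p"
  shows "integrable M S" and "expectation S \<le> (6 * p * \<psi>\<^sup>2 / N) powr (p / 2)"
proof -
  define m where "m i = (\<integral>u. \<bar>g i u - \<mu> i\<bar> powr p \<partial>law)" for i
  have gi: "AE u in law. G e u i = g i u" for i using G by eventually_elim simp
  have mu: "\<mu> i = (\<integral>u. g i u \<partial>law)" for i
    unfolding \<mu>_def mean_vec_def using integral_law_AE_cong(3)[OF xi g gi] .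
  have int_g: "integrable law (g i)" if "i < d" for i
    using G_integrable[OF e that] integral_law_AE_cong(2)[OF xi g gi, of i] by simp
  have "AE u in law. \<bar>G e u i - \<mu> i\<bar> powr p = \<bar>g i u - \<mu> i\<bar> powr p" for i
    using gi[of i] by eventually_elim simp
  note law_p = integral_law_AE_cong[OF xi _ this]
  have gp[measurable]: "(\<lambda>u. \<bar>g i u - \<mu> i\<bar> powr p) \<in> borel_measurable RXi" for i
    using g[of i] by measurable
  have int_p: "integrable law (\<lambda>u. \<bar>g i u - \<mu> i\<bar> powr p)" if "i < d" for i
    using G_moment_finite[OF e that] law_p(2)[OF gp, of i] by (simp add: \<mu>_def)
  have m_eq: "m i = (\<integral>w. \<bar>G e (xi w) i - \<mu> i\<bar> powr p \<partial>M)" for i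
    unfolding m_def using law_p(3)[OF gp, of i] by simp
  have m0: "0 \<le> m i" for i unfolding m_def by simp
  have m_sum: "(\<Sum>i<d. m i) \<le> \<psi> powr p"
  proof -
    have "(\<Sum>i<d. m i) powr (1 / p) \<le> \<psi>"
      using G_moment[OF e] unfolding Lp_norm_def m_eq \<mu>_def by simp
    then have "((\<Sum>i<d. m i) powr (1 / p)) powr p \<le> \<psi> powr p"
      using p by (intro powr_mono2) auto
    then show ?thesis using p m0 by (simp add: powr_powr sum_nonneg)
  qed
  have mean: "integrable M (\<lambda>w. \<bar>(\<Sum>j<N. g i (sample j w) - \<mu> i) / N\<bar> powr p)"
    "expectation (\<lambda>w. \<bar>(\<Sum>j<N. g i (sample j w) - \<mu> i) / N\<bar> powr p) \<le> (6 * p / N) powr (p / 2) * m i"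
    if i: "i < d" for i
  proof -
    have ind: "indep_vars (\<lambda>_. borel) (\<lambda>j w. g i (sample j w) - \<mu> i) {..<N}"
      using indep_vars_compose2[OF sample_indep, of "\<lambda>_ u. g i u - \<mu> i" "\<lambda>_. borel"] g[of i] by simp
    have *: "integrable M (\<lambda>w. \<bar>g i (sample j w) - \<mu> i\<bar> powr p)"
      "expectation (\<lambda>w. g i (sample j w) - \<mu> i) = 0"
      "expectation (\<lambda>w. \<bar>g i (sample j w) - \<mu> i\<bar> powr p) \<le> m i" if j: "j < N" for j
    proof -
      note sj = sample_measurable[OF j]
      show "integrable M (\<lambda>w. \<bar>g i (sample j w) - \<mu> i\<bar> powr p)"
        using int_p[OF i] unfolding sample_law[OF j, symmetric] integrable_distr_eq[OF sj gp] .
      show "expectation (\<lambda>w. \<bar>g i (sample j w) - \<mu> i\<bar> powr p) \<le> m i"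
        unfolding m_def sample_law[OF j, symmetric] integral_distr[OF sj gp] by simp
      have "integrable M (\<lambda>w. g i (sample j w))"
        using int_g[OF i] unfolding sample_law[OF j, symmetric] integrable_distr_eq[OF sj g] .
      moreover have "expectation (\<lambda>w. g i (sample j w)) = \<mu> i"
        unfolding mu sample_law[OF j, symmetric] integral_distr[OF sj g] by simp
      ultimately show "expectation (\<lambda>w. g i (sample j w) - \<mu> i) = 0" by (simp add: prob_space)
    qed
    show "integrable M (\<lambda>w. \<bar>(\<Sum>j<N. g i (sample j w) - \<mu> i) / N\<bar> powr p)"
      using N by (intro mean_indep_moment_bound(1)[OF ind p(1) m0[of i] _ *]) auto
    show "expectation (\<lambda>w. \<bar>(\<Sum>j<N. g i (sample j w) - \<mu> i) / N\<bar> powr p) \<le> (6 * p / N) powr (p / 2) * m i"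
      using N by (intro mean_indep_moment_bound(2)[OF ind p(1) m0[of i] _ *]) auto
  qed
  show "integrable M S" unfolding S_def using mean(1) by (intro Bochner_Integration.integrable_sum) auto
  have "expectation S = (\<Sum>i<d. expectation (\<lambda>w. \<bar>(\<Sum>j<N. g i (sample j w) - \<mu> i) / N\<bar> powr p))"
    unfolding S_def using mean(1) by (intro Bochner_Integration.integral_sum) auto
  also have "\<dots> \<le> (\<Sum>i<d. (6 * p / N) powr (p / 2) * m i)" using mean(2) by (intro sum_mono) auto
  also have "\<dots> \<le> (6 * p / N) powr (p / 2) * \<psi> powr p"
    unfolding sum_distrib_left[symmetric] using m_sum by (intro mult_left_mono) auto
  also have "\<dots> = (6 * p * \<psi>\<^sup>2 / N) powr (p / 2)"
    using abs_powr_eq_power2_powr[of \<psi> p] psi by (simp add: powr_mult powr_divide)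
  finally show "expectation S \<le> (6 * p * \<psi>\<^sup>2 / N) powr (p / 2)" .
qed

lemma error_bounds_224: "error_bounds 224 M d Xopt N \<epsilon> q' R q p \<psi> xhat"
proof -
  obtain e where e: "e \<in> X"
    "\<And>x. x \<in> X \<Longrightarrow> F e + lam * regularizer d q' x0 e \<le> F x + lam * regularizer d q' x0 x"
    using regularized_minimizer_exists[OF G_integrable[OF xstar_Xopt], of q' lam x0] q' lam_pos x0
    by auto
  have e_opt: "e \<in> Xopt"
  proof -
    have "F e \<le> F e + lam * regularizer d q' x0 e"
      using mult_nonneg_nonneg[OF less_imp_le[OF lam_pos] regularizer_nonneg[of d q' x0 e]] by linarith
    also have "\<dots> \<le> F xstar + lam * regularizer d q' x0 xstar" using e(2) xstar(1) by simp
    \<comment> \<open>The choice of \<open>R\<close> bounds the regularizer at \<open>xstar\<close>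
      by \<open>2 * R\<close>, and \<open>lam\<close> was scaled so that the penalty is then at most
      \<open>\<epsilon>\<close>.\<close>
    also have "lam * regularizer d q' x0 xstar \<le> lam * (2 * R)"
      using R lam_pos by (intro mult_left_mono) auto
    also have "\<dots> = \<epsilon>" using R_ge_1 by simp
    finally show ?thesis using e(1) by (simp add: eps_optimal_def)
  qed
  define \<mu> where "\<mu> = mean_vec M (\<lambda>w. G e (xi w))"
  obtain g where g: "\<And>i. g i \<in> borel_measurable RXi" "AE u in law. \<forall>i. G e u i = g i u"
    using G_borel_version[OF e(1)] by blast
  define S where "S w = (\<Sum>i<d. \<bar>(\<Sum>j<N. g i (sample j w) - \<mu> i) / N\<bar> powr p)" for w
  define K where "K = 6 * p * \<psi>\<^sup>2 / N"
  define A where "A = 32 * R\<^sup>2 / ((q' - 1)\<^sup>2 * \<epsilon>\<^sup>2)"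
  \<comment> \<open>The constant is \<open>32 * 7\<close>: the factor \<open>K / 6 + K\<close>
    equals \<open>7 * p * \<psi>^2 / N\<close>, the sixth of \<open>K\<close> paying for
    \<open>\<delta>^2\<close>.\<close>
  define Q where "Q = 224 * p * \<psi>\<^sup>2 * R\<^sup>2 / ((q' - 1)\<^sup>2 * \<epsilon>\<^sup>2)"
  let ?err = "\<lambda>w. (lq_norm d q (e - xhat w))\<^sup>2"
  have S_int: "integrable M S" and S_le: "expectation S \<le> K powr (p / 2)"
    using gradient_noise_moment[OF e_opt g] unfolding S_def[abs_def] K_def \<mu>_def by auto
  have S0: "0 \<le> S w" for w unfolding S_def by (intro sum_nonneg) auto
  have N0: "0 < real N" using N by simp
  have K: "0 < K" unfolding K_def using p psi N0 by simp
  have A: "0 \<le> A" by (simp add: A_def)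
  have delta_sq: "\<delta>\<^sup>2 \<le> K / 6"
  proof -
    have "\<delta>\<^sup>2 \<le> (1 / N)\<^sup>2" using delta by (intro power_mono) auto
    also have "\<dots> = (1 / N) * (1 / N)" by (simp add: power2_eq_square)
    also have "\<dots> \<le> 1 * (1 / N)" using N by (intro mult_right_mono) auto
    also have "\<dots> \<le> (p * \<psi>\<^sup>2) * (1 / N)"
    proof (rule mult_right_mono)
      show "1 \<le> p * \<psi>\<^sup>2" using p psi mult_mono[of 1 p 1 "\<psi>\<^sup>2"] by simp
    qed simp
    finally show ?thesis by (simp add: K_def)
  qed
  have QN: "A * (K / 6 + K) = Q / N"
    by (simp add: A_def K_def Q_def)
  have err_le: "AE w in M. ?err w \<le> A * (\<delta>\<^sup>2 + S w powr (2 / p))"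
    using AE_xhat_approx AE_sample[OF G_subgradient[OF e(1)]] AE_sample[OF g(2)] AE_space
  proof eventually_elim
    case (elim w)
    let ?s = "\<lambda>j\<in>{..<N}. sample j w"
    have h: "xhat w \<in> X" using xhat_in_X elim(4) by simp
    from elim(1) obtain gg where gg:
      "gg \<in> subdifferential d B (saa_objective d f N lam q' x0 ?s) (xhat w)"
      "\<forall>x\<in>X. - \<delta> * lq_norm d q (x - xhat w) \<le> dot d gg (x - xhat w)" by blast
    have "lam * (regularizer d q' x0 (xhat w) - regularizer d q' x0 e)
        + (\<Sum>j<N. dot d (G e (?s j)) (xhat w - e)) / N \<le> \<delta> * lq_norm d q (xhat w - e)"
      using elim(2) by (intro saa_minimizer_comparison[OF e(1) h gg]) auto
    then have saa: "lam * (regularizer d q' x0 (xhat w) - regularizer d q' x0 e)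
        + (\<Sum>j<N. dot d (G e (sample j w)) (xhat w - e)) / N \<le> \<delta> * lq_norm d q (xhat w - e)"
      by simp
    have "lam * ((q' - 1) / 2) * (lq_norm d q' (xhat w - e))\<^sup>2
        \<le> dot d \<mu> (xhat w - e) + lam * (regularizer d q' x0 (xhat w) - regularizer d q' x0 e)"
      using regularized_minimizer_first_order[OF e F_gradient[OF e_opt] q' lam_pos h] by (simp add: \<mu>_def)
    from error_le_gradient_noise[OF this saa]
    have "?err w \<le> A * (\<delta>\<^sup>2 + (lq_norm d p (\<lambda>i. (\<Sum>j<N. G e (sample j w) i - \<mu> i) / N))\<^sup>2)"
      by (simp add: A_def)
    also have "(\<lambda>i. (\<Sum>j<N. G e (sample j w) i - \<mu> i) / N) = (\<lambda>i. (\<Sum>j<N. g i (sample j w) - \<mu> i) / N)"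
      using elim(3) by (intro ext arg_cong2[where f = "(/)"] sum.cong refl) auto
    also have "(lq_norm d p (\<lambda>i. (\<Sum>j<N. g i (sample j w) - \<mu> i) / N))\<^sup>2 = S w powr (2 / p)"
    proof -
      have "(S w powr (1 / p))\<^sup>2 = S w powr (1 / p) * S w powr (1 / p)" by (rule power2_eq_square)
      also have "\<dots> = S w powr (2 / p)" by (simp add: powr_add[symmetric])
      finally show ?thesis by (simp add: lq_norm_def S_def)
    qed
    finally show ?case .
  qed
  have mean_bound: "integrable M ?err \<and> expectation ?err \<le> Q / N"
  proof -
    have U_int: "integrable M (\<lambda>w. S w powr (2 / p))"
      using integrable_powr_smaller[of S 1 "2 / p"] S_int S0 p by simp
    \<comment> \<open>\<open>S w powr (2 / p)\<close> is the squared \<open>p\<close>-norm of the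
      noise; Jensen with exponent \<open>p / 2 \<ge> 1\<close> reduces its mean to the moment bound
      for \<open>S\<close>.\<close>
    have U: "expectation (\<lambda>w. S w powr (2 / p)) \<le> K"
    proof (rule expectation_le_of_powr_expectation_le[OF U_int, of "p / 2"])
      show "integrable M (\<lambda>w. (S w powr (2 / p)) powr (p / 2))"
        using S_int S0 p by (simp add: powr_powr)
      show "expectation (\<lambda>w. (S w powr (2 / p)) powr (p / 2)) \<le> K powr (p / 2)"
        using S_le S0 p by (simp add: powr_powr)
    qed (use p K in auto)
    have bound_int: "integrable M (\<lambda>w. A * (\<delta>\<^sup>2 + S w powr (2 / p)))" using U_int by simp
    have err_int: "integrable M ?err"
    proof (rule Bochner_Integration.integrable_bound[OF bound_int xhat_error_measurable])
      show "AE w in M. norm (?err w) \<le> norm (A * (\<delta>\<^sup>2 + S w powr (2 / p)))"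
        using err_le by eventually_elim simp
    qed
    have "expectation ?err \<le> expectation (\<lambda>w. A * (\<delta>\<^sup>2 + S w powr (2 / p)))"
      using err_int bound_int err_le by (rule integral_mono_AE)
    also have "\<dots> = A * (\<delta>\<^sup>2 + expectation (\<lambda>w. S w powr (2 / p)))"
      using U_int by (simp add: prob_space)
    also have "\<dots> \<le> A * (K / 6 + K)" using A U delta_sq by (intro mult_left_mono add_mono)
    finally show ?thesis using err_int QN by (simp only:)
  qed
  have prob_bound: "1 - \<beta> \<le> prob {w \<in> space M. ?err w \<le> \<theta>}"
    if \<beta>: "0 < \<beta>" "\<beta> < 1" and \<theta>: "Q / N * \<beta> powr (- (2 / p)) \<le> \<theta>" for \<beta> \<theta>
  proof -
    \<comment> \<open>At this threshold Markov's inequality gives probability at most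
      \<open>\<beta>\<close>, and its power \<open>2 / p\<close> is \<open>K * ?b\<close>.\<close>
    let ?c = "K powr (p / 2) / \<beta>" and ?b = "\<beta> powr (- (2 / p))"
    have c: "0 < ?c" using K \<beta> by simp
    have S_meas[measurable]: "S \<in> borel_measurable M" using S_int by simp
    have "prob {w \<in> space M. ?c \<le> S w} \<le> expectation S / ?c"
      using S_int S0 c by (intro integral_Markov_inequality_measure[where A = "{}"]) auto
    also have "\<dots> \<le> K powr (p / 2) / ?c" using S_le c by (intro divide_right_mono) auto
    also have "\<dots> = \<beta>" using K by simp
    finally have "1 - \<beta> \<le> 1 - prob {w \<in> space M. ?c \<le> S w}" by simp
    also have "\<dots> = prob (space M - {w \<in> space M. ?c \<le> S w})"
      by (intro prob_compl[symmetric]) measurable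
    also have "\<dots> \<le> prob {w \<in> space M. ?err w \<le> \<theta>}"
    proof (rule finite_measure_mono_AE)
      show "AE w in M. w \<in> space M - {w \<in> space M. ?c \<le> S w} \<longrightarrow> w \<in> {w \<in> space M. ?err w \<le> \<theta>}"
        using err_le
      proof eventually_elim
        case (elim w)
        show ?case
        proof
          assume w: "w \<in> space M - {w \<in> space M. ?c \<le> S w}"
          then have "S w powr (2 / p) \<le> ?c powr (2 / p)" using S0 p by (intro powr_mono2) auto
          also have "\<dots> = K * ?b"
            using K p by (simp add: powr_divide powr_powr powr_minus_divide)
          finally have SK: "S w powr (2 / p) \<le> K * ?b" .
          \<comment> \<open>Hence the deterministic part \<open>\<delta>^2\<close> also fits into
            the bound enlarged by \<open>?b\<close>.\<close>
          have "1 \<le> ?b"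
            using \<beta> p powr_mono'[of "- (2 / p)" 0 \<beta>] by simp
          then have "K / 6 * 1 \<le> K / 6 * ?b" using K by (intro mult_left_mono) auto
          then have "\<delta>\<^sup>2 + S w powr (2 / p) \<le> K / 6 * ?b + K * ?b" using delta_sq SK by linarith
          then have "A * (\<delta>\<^sup>2 + S w powr (2 / p)) \<le> A * (K / 6 * ?b + K * ?b)"
            using A by (intro mult_left_mono)
          also have "\<dots> = A * (K / 6 + K) * ?b" by (simp add: algebra_simps)
          also have "\<dots> \<le> \<theta>" using \<theta> QN by simp
          finally show "w \<in> {w \<in> space M. ?err w \<le> \<theta>}" using elim w by simp
        qed
      qed
      show "{w \<in> space M. ?err w \<le> \<theta>} \<in> events"
        using xhat_error_measurable[of e] by measurable
    qed
    finally show ?thesis .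
  qed
  have Q_\<theta>: "224 * p * \<psi>\<^sup>2 * R\<^sup>2 / ((q' - 1)\<^sup>2 * \<epsilon>\<^sup>2 * \<theta>) = Q / \<theta>" for \<theta>
    by (simp add: Q_def)
  show ?thesis
    unfolding error_bounds_def Q_\<theta>
  proof (intro bexI[OF _ e_opt] allI impI conjI)
    fix \<theta> \<beta> :: real
    assume \<theta>: "0 < \<theta>" and \<beta>: "0 < \<beta> \<and> \<beta> < 1"
    {
      assume "Q / \<theta> \<le> real N"
      then have "Q / N \<le> \<theta>" using \<theta> N0 by (simp add: field_simps)
      then show "integrable M ?err" "expectation ?err \<le> \<theta>" using mean_bound by auto
    next
      assume "Q / \<theta> * \<beta> powr (- (2 / p)) \<le> real N"
      then have "Q / N * \<beta> powr (- (2 / p)) \<le> \<theta>" using \<theta> N0 by (simp add: field_simps)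
      then show "1 - \<beta> \<le> prob {w \<in> space M. ?err w \<le> \<theta>}" using \<beta> prob_bound by auto
    }
  qed
qed

end

section \<open>Dependence on the law only\<close>

context stochastic_program
begin

lemma law_transfer:
  fixes g h :: "rvec \<Rightarrow> real"
  assumes "complete_measure M'" and xi': "xi' \<in> M' \<rightarrow>\<^sub>M RXi" and law': "distr M' RXi xi' = law"
    and g: "g \<in> borel_measurable RXi" "AE u in law. h u = g u"
  shows "integrable M' (\<lambda>w. h (xi' w)) \<longleftrightarrow> integrable M (\<lambda>w. h (xi w))"
    and "(\<integral>w. h (xi' w) \<partial>M') = (\<integral>w. h (xi w) \<partial>M)"
proof -
  interpret M': complete_measure M' by fact
  show "integrable M' (\<lambda>w. h (xi' w)) \<longleftrightarrow> integrable M (\<lambda>w. h (xi w))"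
    using integral_law_AE_cong(2)[OF xi g] M'.integral_law_AE_cong(2)[OF xi' g(1) g(2)[folded law']] law' by simp
  show "(\<integral>w. h (xi' w) \<partial>M') = (\<integral>w. h (xi w) \<partial>M)"
    using integral_law_AE_cong(3)[OF xi g] M'.integral_law_AE_cong(3)[OF xi' g(1) g(2)[folded law']] law' by simp
qed

lemma
  assumes xi': "xi' \<in> M' \<rightarrow>\<^sub>M RXi" and law': "distr M' RXi xi' = law" and x: "x \<in> B"
  shows integrable_f_law_cong: "integrable M' (\<lambda>w. f x (xi' w)) \<longleftrightarrow> integrable M (\<lambda>w. f x (xi w))"
    and expected_cost_law_cong: "expected_cost M' xi' f x = F x"
  using integrable_distr_eq[OF xi' f_measurable[OF x]] integrable_distr_eq[OF xi f_measurable[OF x]]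
    integral_distr[OF xi' f_measurable[OF x]] integral_distr[OF xi f_measurable[OF x]]
  unfolding law' expected_cost_def by simp_all

lemma eps_optimal_law_cong:
  assumes "xi' \<in> M' \<rightarrow>\<^sub>M RXi" "distr M' RXi xi' = law"
  shows "eps_optimal X (expected_cost M' xi' f) xstar \<epsilon> = eps_optimal X F xstar \<epsilon>"
proof -
  have "expected_cost M' xi' f x = F x" if "x \<in> X" for x
    using expected_cost_law_cong[OF assms] X(2) that by blast
  then show ?thesis unfolding eps_optimal_def using xstar(1) by auto
qed

lemma prob_space_law: "prob_space law"
  using xi by (rule prob_space_distr)

lemma measurable_completion_PiM_component:
  "j \<in> I \<Longrightarrow> (\<lambda>s. s j) \<in> completion (\<Pi>\<^sub>M j\<in>I. law) \<rightarrow>\<^sub>M RXi"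
  using measurable_component_singleton[of j I "\<lambda>_. law"] by (intro measurable_completion) simp

lemma distr_completion_PiM_component:
  assumes "j \<in> I"
  shows "distr (completion (\<Pi>\<^sub>M j\<in>I. law)) RXi (\<lambda>s. s j) = law"
proof -
  have "distr (completion (\<Pi>\<^sub>M j\<in>I. law)) RXi (\<lambda>s. s j) = distr (\<Pi>\<^sub>M j\<in>I. law) RXi (\<lambda>s. s j)"
    using measurable_component_singleton[of j I "\<lambda>_. law"] assms by (intro distr_completion) simp
  also have "\<dots> = distr (\<Pi>\<^sub>M j\<in>I. law) law (\<lambda>s. s j)" by (intro distr_cong) auto
  also have "\<dots> = law" using assms by (intro distr_PiM_component prob_space_law)
  finally show ?thesis .
qed

end

text \<open>Differentiability is local. Expected costs on two outcome spaces are compared only on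
  \<open>B\<close>, while \<open>has_gradient\<close> quantifies over all of \<open>Rn d\<close>, so
  the radius is shrunk into an open set.\<close>

lemma has_gradient_cong:
  assumes grad: "has_gradient d h v z" and U: "openin (Euclidean_space d) U" "z \<in> U"
    and eq: "\<And>y. y \<in> U \<Longrightarrow> h' y = h y"
  shows "has_gradient d h' v z"
proof -
  obtain r0 where r0: "0 < r0" "\<And>y. y \<in> Rn d \<Longrightarrow> lq_norm d 2 (y - z) < r0 \<Longrightarrow> y \<in> U"
    using openin_Euclidean_space_contains_ball[OF U] by blast
  show ?thesis
    unfolding has_gradient_def
  proof (intro conjI allI impI)
    show "v \<in> Rn d" using grad by (simp add: has_gradient_def)
    fix e :: real assume "0 < e"
    then obtain r where r: "0 < r" "\<And>y. y \<in> Rn d \<Longrightarrow> lq_norm d 2 (y - z) < r \<Longrightarrow>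
        \<bar>h y - h z - dot d v (y - z)\<bar> \<le> e * lq_norm d 2 (y - z)"
      using grad unfolding has_gradient_def by blast
    show "\<exists>r>0. \<forall>y\<in>Rn d. lq_norm d 2 (y - z) < r \<longrightarrow>
        \<bar>h' y - h' z - dot d v (y - z)\<bar> \<le> e * lq_norm d 2 (y - z)"
    proof (intro exI[of _ "min r r0"] conjI ballI impI)
      show "0 < min r r0" using r r0 by simp
      fix y assume y: "y \<in> Rn d" "lq_norm d 2 (y - z) < min r r0"
      then have "h' y = h y" "h' z = h z" using r0 eq U(2) by auto
      then show "\<bar>h' y - h' z - dot d v (y - z)\<bar> \<le> e * lq_norm d 2 (y - z)"
        using r(2)[of y] y by simp
    qed
  qed
qed

context regularized_saa
begin

text \<open>The outcome space enters the assumptions only through the law of \<open>xi\<close>, the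
  law of the sample and integrals of functions of \<open>xi\<close>, all of which survive the change
  of space.\<close>

lemma regularized_saa_law_cong:
  assumes "prob_space M'" "complete_measure M'"
    and xi': "xi' \<in> M' \<rightarrow>\<^sub>M RXi" and law': "distr M' RXi xi' = law"
    and indep': "prob_space.indep_vars M' (\<lambda>_. RXi) sample' {..<N}"
    and sample_law': "\<And>j. j < N \<Longrightarrow> distr M' RXi (sample' j) = law"
  shows "regularized_saa M' d m Xi xi' B X f xstar G N sample' \<epsilon> q' x0 R q \<delta> xt p \<psi>"
proof -
  interpret M': prob_space M' by fact
  note transfer = law_transfer[OF assms(2) xi' law']
  note f_int' = integrable_f_law_cong[OF xi' law'] and F' = expected_cost_law_cong[OF xi' law']
  note Xopt' = eps_optimal_law_cong[OF xi' law']
  \<comment> \<open>Expectations of \<open>G z\<close> are compared through a Borel version, because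
    \<open>G\<close> is only universally measurable; completeness of both spaces enters
    here.\<close>
  have mean': "mean_vec M' (\<lambda>w. G z (xi' w)) = mean_vec M (\<lambda>w. G z (xi w))"
    and G_int': "\<And>i. integrable M' (\<lambda>w. G z (xi' w) i) \<longleftrightarrow> integrable M (\<lambda>w. G z (xi w) i)"
    and G_p': "\<And>c i. integrable M' (\<lambda>w. \<bar>G z (xi' w) i - c\<bar> powr p) \<longleftrightarrow> integrable M (\<lambda>w. \<bar>G z (xi w) i - c\<bar> powr p)"
      "\<And>c i. (\<integral>w. \<bar>G z (xi' w) i - c\<bar> powr p \<partial>M') = (\<integral>w. \<bar>G z (xi w) i - c\<bar> powr p \<partial>M)"
    if z: "z \<in> X" for z
  proof -
    obtain g where g[measurable]: "\<And>i. g i \<in> borel_measurable RXi" and G: "AE u in law. \<forall>i. G z u i = g i u"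
      using G_borel_version[OF z] by blast
    have gi: "AE u in law. G z u i = g i u" for i using G by eventually_elim simp
    show "mean_vec M' (\<lambda>w. G z (xi' w)) = mean_vec M (\<lambda>w. G z (xi w))"
      unfolding mean_vec_def using transfer(2)[OF g gi] by simp
    show "integrable M' (\<lambda>w. G z (xi' w) i) \<longleftrightarrow> integrable M (\<lambda>w. G z (xi w) i)" for i
      using transfer(1)[OF g gi] .
    have "AE u in law. \<bar>G z u i - c\<bar> powr p = \<bar>g i u - c\<bar> powr p" for i c
      using gi[of i] by eventually_elim simp
    note transfer_p = transfer[OF _ this]
    have "(\<lambda>u. \<bar>g i u - c\<bar> powr p) \<in> borel_measurable RXi" for i c by measurable
    from transfer_p[OF this]
    show "integrable M' (\<lambda>w. \<bar>G z (xi' w) i - c\<bar> powr p) \<longleftrightarrow> integrable M (\<lambda>w. \<bar>G z (xi w) i - c\<bar> powr p)"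
      "(\<integral>w. \<bar>G z (xi' w) i - c\<bar> powr p \<partial>M') = (\<integral>w. \<bar>G z (xi w) i - c\<bar> powr p \<partial>M)" for c i
      by auto
  qed
  have sp: "stochastic_program M' d m Xi xi' B X f xstar G"
  proof (intro stochastic_program.intro stochastic_program_axioms.intro)
    show "x \<in> X \<Longrightarrow> integrable M' (\<lambda>w. f x (xi' w))" for x
      using f_int' F_finite X(2) by auto
    show "x \<in> X \<Longrightarrow> expected_cost M' xi' f xstar \<le> expected_cost M' xi' f x" for x
      using F' xstar X(2) by (metis subsetD)
    show "x \<in> X \<Longrightarrow> AE u in distr M' RXi xi'. G x u \<in> subdifferential d B (\<lambda>y. f y u) x" for x
      unfolding law' by (rule G_subgradient)
  qed (fact assms dims Xi B X f xstar(1) G_measurable)+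
  show ?thesis
  proof (intro regularized_saa.intro[OF sp] regularized_saa_axioms.intro, unfold law' Xopt')
    fix z i assume z: "z \<in> Xopt"
    then have zX: "z \<in> X" and zB: "z \<in> B" using Xopt_subset X(2) by auto
    show "\<exists>U. openin (Euclidean_space d) U \<and> z \<in> U \<and> U \<subseteq> B \<and> (\<forall>x\<in>U. integrable M' (\<lambda>w. f x (xi' w)))"
      using F_finite_near[OF z] f_int' by (metis subsetD)
    show "has_gradient d (expected_cost M' xi' f) (mean_vec M' (\<lambda>w. G z (xi' w))) z"
      unfolding mean'[OF zX] using F_gradient[OF z] B(1) zB F' by (rule has_gradient_cong)
    show "Lp_norm d p M' (\<lambda>w. G z (xi' w) - mean_vec M' (\<lambda>w. G z (xi' w))) \<le> \<psi>"
      using G_moment[OF z] unfolding Lp_norm_def mean'[OF zX] by (simp add: G_p'(2)[OF zX])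
    assume i: "i < d"
    show "integrable M' (\<lambda>w. G z (xi' w) i)"
      using G_integrable[OF z i] G_int'[OF zX] by simp
    show "integrable M' (\<lambda>w. \<bar>(G z (xi' w) - mean_vec M' (\<lambda>w. G z (xi' w))) i\<bar> powr p)"
      using G_moment_finite[OF z i] unfolding mean'[OF zX] by (simp add: G_p'(1)[OF zX])
  qed (fact N indep' sample_law' eps q' x0 R q delta xt_measurable xt_approx f_convex p psi)+
qed

text \<open>The estimator is a measurable function of the sample tuple, so mean and probability of
  its error are integrals against the product law. Problems on different outcome spaces become
  comparable there.\<close>

lemma error_bounds_iff_sample_law:
  "error_bounds C M d S N \<epsilon> q' R q p \<psi> xhat
    \<longleftrightarrow> error_bounds C (\<Pi>\<^sub>M j\<in>{..<N}. law) d S N \<epsilon> q' R q p \<psi> xt"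
proof -
  let ?tuple = "\<lambda>w. \<lambda>j\<in>{..<N}. sample j w" and ?P = "\<Pi>\<^sub>M j\<in>{..<N}. RXi" and ?L = "\<Pi>\<^sub>M j\<in>{..<N}. law"
  note tuple = sample_tuple_measurable
  have err: "(\<lambda>s. (lq_norm d q (c - xt s))\<^sup>2) \<in> borel_measurable ?P" for c
  proof -
    have "xt \<in> borel_measurable ?P"
      using xt_measurable by (simp add: measurable_restrict_space2_iff)
    from measurable_compose[OF this borel_measurable_lq_norm[of q d c]]
    have "(\<lambda>s. lq_norm d q (c - xt s)) \<in> borel_measurable ?P"
      using q q' by (subst lq_norm_minus_commute) simp
    then show ?thesis by (rule borel_measurable_power)
  qed
  have int: "integrable M (\<lambda>w. (lq_norm d q (c - xhat w))\<^sup>2) \<longleftrightarrow> integrable ?L (\<lambda>s. (lq_norm d q (c - xt s))\<^sup>2)" for c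
    unfolding sample_tuple_law[symmetric] saa_estimator_def by (rule integrable_distr_eq[OF tuple err, symmetric])
  have exp: "(\<integral>w. (lq_norm d q (c - xhat w))\<^sup>2 \<partial>M) = (\<integral>s. (lq_norm d q (c - xt s))\<^sup>2 \<partial>?L)" for c
    unfolding sample_tuple_law[symmetric] saa_estimator_def by (rule integral_distr[OF tuple err, symmetric])
  have prob: "measure M {w \<in> space M. (lq_norm d q (c - xhat w))\<^sup>2 \<le> \<theta>}
      = measure ?L {s \<in> space ?L. (lq_norm d q (c - xt s))\<^sup>2 \<le> \<theta>}" for c \<theta>
  proof -
    have "{s \<in> space ?P. (lq_norm d q (c - xt s))\<^sup>2 \<le> \<theta>} \<in> sets ?P" using err[of c] by measurable
    then have "measure ?L {s \<in> space ?P. (lq_norm d q (c - xt s))\<^sup>2 \<le> \<theta>}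
        = measure M (?tuple -` {s \<in> space ?P. (lq_norm d q (c - xt s))\<^sup>2 \<le> \<theta>} \<inter> space M)"
      unfolding sample_tuple_law[symmetric] by (rule measure_distr[OF tuple])
    also have "?tuple -` {s \<in> space ?P. (lq_norm d q (c - xt s))\<^sup>2 \<le> \<theta>} \<inter> space M
        = {w \<in> space M. (lq_norm d q (c - xhat w))\<^sup>2 \<le> \<theta>}"
      using measurable_space[OF tuple] by (auto simp: saa_estimator_def)
    finally have "measure ?L {s \<in> space ?P. (lq_norm d q (c - xt s))\<^sup>2 \<le> \<theta>}
        = measure M {w \<in> space M. (lq_norm d q (c - xhat w))\<^sup>2 \<le> \<theta>}" .
    moreover have "space ?L = space ?P" by (simp add: space_PiM)
    ultimately show ?thesis by (simp only:)
  qed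
  show ?thesis unfolding error_bounds_def int exp prob ..
qed

text \<open>The index set has \<open>N + 1\<close> elements: coordinates below \<open>N\<close> form
  the sample and coordinate \<open>N\<close> plays \<open>xi\<close>. Completion supplies the
  complete measure that the locale demands and leaves the coordinate laws unchanged.\<close>

lemma regularized_saa_product_space:
  "regularized_saa (completion (\<Pi>\<^sub>M j\<in>{..N}. law)) d m Xi (\<lambda>s. s N) B X f xstar G N (\<lambda>j s. s j)
     \<epsilon> q' x0 R q \<delta> xt p \<psi>"
proof -
  let ?P = "\<Pi>\<^sub>M j\<in>{..N}. law"
  interpret P: prob_space ?P by (intro prob_space_PiM prob_space_law)
  interpret P': prob_space "completion ?P" by (rule P.prob_space_completion)
  note comp = measurable_completion_PiM_component[of _ "{..N}"]
  note comp_law = distr_completion_PiM_component[of _ "{..N}"]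
  have "distr (completion ?P) (\<Pi>\<^sub>M j\<in>{..<N}. RXi) (\<lambda>s. \<lambda>j\<in>{..<N}. s j)
      = distr ?P (\<Pi>\<^sub>M j\<in>{..<N}. RXi) (\<lambda>s. \<lambda>j\<in>{..<N}. s j)"
    using measurable_component_singleton[of _ "{..N}" "\<lambda>_. law"]
    by (intro distr_completion measurable_restrict) auto
  also have "\<dots> = distr ?P (\<Pi>\<^sub>M j\<in>{..<N}. law) (\<lambda>s. \<lambda>j\<in>{..<N}. s j)"
    by (intro distr_cong sets_PiM_cong) auto
  also have "\<dots> = (\<Pi>\<^sub>M j\<in>{..<N}. law)"
    by (intro distr_PiM_reindex[where f = "\<lambda>j. j"] prob_space_law) auto
  also have "\<dots> = (\<Pi>\<^sub>M j\<in>{..<N}. distr (completion ?P) RXi (\<lambda>s. s j))"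
    using comp_law by (intro PiM_cong) auto
  finally have "P'.indep_vars (\<lambda>_. RXi) (\<lambda>j s. s j) {..<N}"
    using N comp by (subst P'.indep_vars_iff_distr_eq_PiM') (auto simp: lessThan_empty_iff)
  then show ?thesis
    using comp comp_law P'.prob_space_axioms by (intro regularized_saa_law_cong completion.complete_measure_axioms) auto
qed

end

section \<open>The universal constant and its transfer to every outcome type\<close>

lemma C11_works_on_sequences:
  "0 < C11 \<and>
    (\<forall>(M :: (nat \<Rightarrow> rvec) measure) d m Xi xi B X f xstar G N sample \<epsilon> q' x0 R q \<delta> xt p \<psi>.
      regularized_saa M d m Xi xi B X f xstar G N sample \<epsilon> q' x0 R q \<delta> xt p \<psi> \<longrightarrow>
      error_bounds C11 M d (eps_optimal X (expected_cost M xi f) xstar \<epsilon>) N \<epsilon> q' R q p \<psi>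
        (saa_estimator N sample xt))"
  unfolding C11_def
  \<comment> \<open>224 only witnesses that the choice is not vacuous; \<open>C11\<close> itself is
    whichever valid number the choice operator selects.\<close>
  by (rule someI[of _ 224]) (auto intro: regularized_saa.error_bounds_224)

theorem theorem5:
  fixes M :: "'w measure"
  shows "0 < C11 \<and>
    (\<forall>d m Xi xi B X f xstar G N sample \<epsilon> q' x0 R q \<delta> xt p \<psi>.
      regularized_saa M d m Xi xi B X f xstar G N sample \<epsilon> q' x0 R q \<delta> xt p \<psi> \<longrightarrow>
      error_bounds C11 M d (eps_optimal X (expected_cost M xi f) xstar \<epsilon>) N \<epsilon> q' R q p \<psi>
        (saa_estimator N sample xt))"
proof (intro conjI allI impI)
  show "0 < C11" using C11_works_on_sequences by blast
  fix d m Xi and xi :: "'w \<Rightarrow> rvec" and B X f xstar G N sample \<epsilon> q' x0 R q \<delta> xt p \<psi>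
  assume "regularized_saa M d m Xi xi B X f xstar G N sample \<epsilon> q' x0 R q \<delta> xt p \<psi>"
  then interpret S: regularized_saa M d m Xi xi B X f xstar G N sample \<epsilon> q' x0 R q \<delta> xt p \<psi> .
  \<comment> \<open>Outcomes are now sequences of vectors, the type for which \<open>C11\<close> was
    chosen.\<close>
  let ?M = "completion (\<Pi>\<^sub>M j\<in>{..N}. S.law)"
  interpret S': regularized_saa ?M d m Xi "\<lambda>s. s N" B X f xstar G N "\<lambda>j s. s j" \<epsilon> q' x0 R q \<delta> xt p \<psi>
    by (rule S.regularized_saa_product_space)
  have law: "S'.law = S.law" by (rule S.distr_completion_PiM_component) simp
  have "error_bounds C11 ?M d S'.Xopt N \<epsilon> q' R q p \<psi> S'.xhat"
    by (rule C11_works_on_sequences[THEN conjunct2, rule_format, OF S'.regularized_saa_axioms])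
  \<comment> \<open>Both claims become the same statement about the product of \<open>N\<close>
    copies of the common law, over the same set of \<open>\<epsilon>\<close>-optimal points.\<close>
  then show "error_bounds C11 M d S.Xopt N \<epsilon> q' R q p \<psi> S.xhat"
    unfolding S.error_bounds_iff_sample_law S'.error_bounds_iff_sample_law law
      S.eps_optimal_law_cong[OF S'.xi law] .
qed

end
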